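(* Let $n\ge2$ and, for $i=1,\dots,n$, let $a_i,b_i,\alpha_i,\beta_i,\lambda_i\in\mathbb{C}$. On $\mathbb{R}^4$ put $$L_i=\tfrac{1}{\sqrt2}\big[(\lambda_i\alpha_i+\beta_i)x^1+(\lambda_i\beta_i-\alpha_i)x^2+(\lambda_i\alpha_i-\beta_i)x^3+(\lambda_i\beta_i+\alpha_i)x^4\big],$$ $$\psi_i=\begin{pmatrix}a_ie^{L_i}&\overline b_ie^{-\overline L_i}\\-b_ie^{-L_i}&\overline a_ie^{\overline L_i}\end{pmatrix},\quad\Lambda_i=\begin{pmatrix}\lambda_i&0\\0&\overline\lambda_i\end{pmatrix},\quad X_i=L_i+\overline L_i+\log|a_i/b_i|,$$ and assume that $L_1,\dots,L_n$ are mutually independent (only pure soliton scattering is considered; resonance processes are excluded). Let $J_{n+1}$ be the $n$-soliton quasi-Wronskian built from $(\psi_i,\Lambda_i)_{i=1}^n$. Fix $I\in\{1,\dots,n\}$, keep $L_I$ (and $\overline L_I$) finite, and let $r:=\big[\sum_\mu(x^\mu)^2\big]^{1/2}\to\infty$, so that for each $i\neq I$ either $\mathrm{Re}\,L_i\to+\infty$ (put $\epsilon_i=+1$) or $\mathrm{Re}\,L_i\to-\infty$ (put $\epsilon_i=-1$). Then $J_{n+1}$ tends to the asymptotic form $$\widetilde J^{(I)}_{n+1}=-\widetilde\Psi\,\Lambda_I\,\widetilde\Psi^{-1}D,\qquad \widetilde\Psi=\begin{pmatrix}a_I'e^{L_I}&\overline{b_I'}\,e^{-\overline L_I}\\-b_I'e^{-L_I}&\overline{a_I'}\,e^{\overline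 L_I}\end{pmatrix},$$ where, with $\lambda_i^{(+1)}:=\lambda_i$ and $\lambda_i^{(-1)}:=\overline\lambda_i$, $$a_I'=a_I\prod_{i\neq I}\big(\lambda_I-\lambda_i^{(\epsilon_i)}\big),\quad b_I'=b_I\prod_{i\neq I}\big(\lambda_I-\lambda_i^{(-\epsilon_i)}\big),\quad D=(-1)^{n-1}\prod_{i\neq I}\mathrm{diag}\big(\lambda_i^{(\epsilon_i)},\lambda_i^{(-\epsilon_i)}\big).$$ Consequently the asymptotic Lagrangian density (that given by $\widetilde J^{(I)}_{n+1}$) is the Lagrangian density of the $I$-th 1-soliton up to a phase shift: $$\mathrm{Tr}F_{\mu\nu}F^{\mu\nu}=8\big[(\alpha_I\overline\beta_I-\overline\alpha_I\beta_I)(\lambda_I-\overline\lambda_I)\big]^2\big(2\,\mathrm{sech}^2X_I'-3\,\mathrm{sech}^4X_I'\big),\qquad X_I'=X_I+\Delta_I,$$ with the real phase shift $$\Delta_I=\sum_{i\neq I}\epsilon_i\log\left|\frac{\lambda_I-\lambda_i}{\lambda_I-\overline\lambda_i}\right|.$$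
   Context: $\mathbb{R}^4$ carries the split metric $ds^2=(dx^1)^2+(dx^2)^2-(dx^3)^2-(dx^4)^2$, used to raise indices; repeated indices are summed; $F_{\mu\nu}=\partial_\mu A_\nu-\partial_\nu A_\mu+[A_\mu,A_\nu]$. The Lagrangian density given by a $2\times2$ matrix function $J$ is $\mathrm{Tr}F_{\mu\nu}F^{\mu\nu}$ for the gauge fields $A_1=A_3=-\frac12[(\partial_1J)J^{-1}+(\partial_3J)J^{-1}]$, $A_2=A_4=-\frac12[(\partial_2J)J^{-1}+(\partial_4J)J^{-1}]$. The $n$-soliton quasi-Wronskian is the $2\times2$ matrix function given by the quasideterminant $$J_{n+1}=\begin{vmatrix}\psi_1&\cdots&\psi_n&1\\\psi_1\Lambda_1&\cdots&\psi_n\Lambda_n&0\\\vdots&&\vdots&\vdots\\\psi_1\Lambda_1^{n}&\cdots&\psi_n\Lambda_n^{n}&\boxed{0}\end{vmatrix}=-\big(\psi_1\Lambda_1^n,\dots,\psi_n\Lambda_n^n\big)\,W^{-1}\,(1,0,\dots,0)^T,$$ where $W$ is the $n\times n$ block matrix (with $2\times 2$ blocks) whose $(r,s)$ block is $\psi_s\Lambda_s^{r-1}$, assumed invertible, and $1$ and $0$ denote the $2\times2$ identity and zero matrices. The 1-soliton with data $(\psi_I,\Lambda_I)$ is $J=-\psi_I\Lambda_I\psi_I^{-1}$; its Lagrangian density is the expression above with $X_I'$ replaced by $X_I$. *)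

theory Defs
  imports "HOL-Analysis.Analysis"
begin

type_synonym mat22 = "complex^2^2"

definition mat2 :: "complex \<Rightarrow> complex \<Rightarrow> complex \<Rightarrow> complex \<Rightarrow> mat22" where
  "mat2 a b c d = vector [vector [a, b], vector [c, d]]"

text \<open>On \<^typ>\<open>complex^2^2\<close> the library's \<open>*\<close> and \<open>^\<close> are entrywise, so matrix powers are
  iterated \<open>**\<close>.\<close>

definition mat_pow :: "'a::semiring_1^'m^'m \<Rightarrow> nat \<Rightarrow> 'a^'m^'m" where
  "mat_pow A k = (((**) A) ^^ k) (mat 1)"

text \<open>A block matrix is a function of its row and column index; only the entries with row index
  in a finite set \<open>R\<close> and column index in a finite set \<open>C\<close> are relevant. The entries of an
  inverse have their row index in \<open>C\<close> and their column index in \<open>R\<close>.\<close>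

definition is_block_inverse ::
  "nat set \<Rightarrow> nat set \<Rightarrow> (nat \<Rightarrow> nat \<Rightarrow> 'a::ring_1^'m^'m) \<Rightarrow> (nat \<Rightarrow> nat \<Rightarrow> 'a^'m^'m) \<Rightarrow> bool" where
  "is_block_inverse R C A V \<longleftrightarrow>
     (\<forall>r\<in>R. \<forall>r'\<in>R. (\<Sum>s\<in>C. A r s ** V s r') = (if r = r' then mat 1 else 0)) \<and>
     (\<forall>s\<in>C. \<forall>s'\<in>C. (\<Sum>r\<in>R. V s r ** A r s') = (if s = s' then mat 1 else 0))"

definition block_invertible ::
  "nat set \<Rightarrow> nat set \<Rightarrow> (nat \<Rightarrow> nat \<Rightarrow> 'a::ring_1^'m^'m) \<Rightarrow> bool" where
  "block_invertible R C A \<longleftrightarrow> (\<exists>V. is_block_inverse R C A V)"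

definition block_inv ::
  "nat set \<Rightarrow> nat set \<Rightarrow> (nat \<Rightarrow> nat \<Rightarrow> 'a::ring_1^'m^'m) \<Rightarrow> nat \<Rightarrow> nat \<Rightarrow> 'a^'m^'m" where
  "block_inv R C A = (SOME V. is_block_inverse R C A V)"

text \<open>The quasideterminant with box at \<open>(p, q)\<close> of the block matrix with index set
  \<open>{1..N} \<times> {1..N}\<close>.\<close>

definition quasidet ::
  "nat \<Rightarrow> nat \<Rightarrow> nat \<Rightarrow> (nat \<Rightarrow> nat \<Rightarrow> 'a::ring_1^'m^'m) \<Rightarrow> 'a^'m^'m" where
  "quasidet N p q A =
     (let R = {1..N} - {p}; C = {1..N} - {q}; V = block_inv R C A
      in A p q - (\<Sum>s\<in>C. \<Sum>r\<in>R. A p s ** V s r ** A r q))"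

definition split_metric :: "4 \<Rightarrow> 4 \<Rightarrow> real" where
  "split_metric \<mu> \<nu> = (if \<mu> = \<nu> then (if \<mu> = 1 \<or> \<mu> = 2 then 1 else -1) else 0)"

definition pderiv_dir :: "4 \<Rightarrow> (real^4 \<Rightarrow> mat22) \<Rightarrow> real^4 \<Rightarrow> mat22" where
  "pderiv_dir \<mu> f x = vector_derivative (\<lambda>t. f (x + t *\<^sub>R axis \<mu> 1)) (at 0)"

definition field_strength :: "(4 \<Rightarrow> real^4 \<Rightarrow> mat22) \<Rightarrow> 4 \<Rightarrow> 4 \<Rightarrow> real^4 \<Rightarrow> mat22" where
  "field_strength A \<mu> \<nu> x =
     pderiv_dir \<mu> (A \<nu>) x - pderiv_dir \<nu> (A \<mu>) x + (A \<mu> x ** A \<nu> x - A \<nu> x ** A \<mu> x)"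

text \<open>The split metric is its own inverse, so indices are raised with its components.\<close>

definition field_strength_up :: "(4 \<Rightarrow> real^4 \<Rightarrow> mat22) \<Rightarrow> 4 \<Rightarrow> 4 \<Rightarrow> real^4 \<Rightarrow> mat22" where
  "field_strength_up A \<mu> \<nu> x =
     (\<Sum>\<rho>\<in>UNIV. \<Sum>\<sigma>\<in>UNIV.
        (split_metric \<mu> \<rho> * split_metric \<nu> \<sigma>) *\<^sub>R field_strength A \<rho> \<sigma> x)"

definition gauge_field :: "(real^4 \<Rightarrow> mat22) \<Rightarrow> 4 \<Rightarrow> real^4 \<Rightarrow> mat22" where
  "gauge_field J \<mu> x =
     (let B = (\<lambda>\<rho> \<sigma>. (- 1 / 2) *\<^sub>R (pderiv_dir \<rho> J x ** matrix_inv (J x)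
                                   + pderiv_dir \<sigma> J x ** matrix_inv (J x)))
      in if \<mu> = 1 \<or> \<mu> = 3 then B 1 3 else B 2 4)"

definition lagrangian_density :: "(real^4 \<Rightarrow> mat22) \<Rightarrow> real^4 \<Rightarrow> complex" where
  "lagrangian_density J x =
     (let A = gauge_field J
      in trace (\<Sum>\<mu>\<in>UNIV. \<Sum>\<nu>\<in>UNIV. field_strength A \<mu> \<nu> x ** field_strength_up A \<mu> \<nu> x))"

definition Lfun :: "complex \<Rightarrow> complex \<Rightarrow> complex \<Rightarrow> real^4 \<Rightarrow> complex" where
  "Lfun \<alpha> \<beta> l x = 1 / complex_of_real (sqrt 2) *
     ((l * \<alpha> + \<beta>) * of_real (x $ 1) + (l * \<beta> - \<alpha>) * of_real (x $ 2)
      + (l * \<alpha> - \<beta>) * of_real (x $ 3) + (l * \<beta> + \<alpha>) * of_real (x $ 4))"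

definition Psi :: "complex \<Rightarrow> complex \<Rightarrow> complex \<Rightarrow> mat22" where
  "Psi a b L = mat2 (a * exp L) (cnj b * exp (- cnj L)) (- b * exp (- L)) (cnj a * exp (cnj L))"

definition Lam :: "complex \<Rightarrow> mat22" where
  "Lam l = mat2 l 0 0 (cnj l)"

definition Xfun :: "complex \<Rightarrow> complex \<Rightarrow> complex \<Rightarrow> real" where
  "Xfun a b L = Re (L + cnj L) + ln (cmod (a / b))"

definition one_soliton :: "complex \<Rightarrow> complex \<Rightarrow> complex \<Rightarrow> complex \<Rightarrow> mat22" where
  "one_soliton a b l L = - (Psi a b L ** Lam l ** matrix_inv (Psi a b L))"

text \<open>\<open>wronski_block \<psi> \<Lambda> r s\<close> is the block \<open>\<psi>\<^sub>s \<Lambda>\<^sub>s\<^sup>r\<^sup>-\<^sup>1\<close> of the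
  matrix \<open>W\<close>, indices starting at 1.\<close>

definition wronski_block :: "(nat \<Rightarrow> mat22) \<Rightarrow> (nat \<Rightarrow> mat22) \<Rightarrow> nat \<Rightarrow> nat \<Rightarrow> mat22" where
  "wronski_block \<psi> \<Lambda> r s = \<psi> s ** mat_pow (\<Lambda> s) (r - 1)"

definition quasi_wronskian :: "nat \<Rightarrow> (nat \<Rightarrow> mat22) \<Rightarrow> (nat \<Rightarrow> mat22) \<Rightarrow> mat22" where
  "quasi_wronskian n \<psi> \<Lambda> =
     quasidet (n + 1) (n + 1) (n + 1)
       (\<lambda>r s. if s \<le> n then wronski_block \<psi> \<Lambda> r s else if r = 1 then mat 1 else 0)"

definition lam_sgn :: "complex \<Rightarrow> real \<Rightarrow> complex" where
  "lam_sgn l e = (if e = 1 then l else cnj l)"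

definition a_asym :: "nat \<Rightarrow> (nat \<Rightarrow> complex) \<Rightarrow> (nat \<Rightarrow> complex) \<Rightarrow> (nat \<Rightarrow> real) \<Rightarrow> nat \<Rightarrow> complex" where
  "a_asym n a l \<epsilon> I = a I * (\<Prod>i\<in>{1..n} - {I}. l I - lam_sgn (l i) (\<epsilon> i))"

definition b_asym :: "nat \<Rightarrow> (nat \<Rightarrow> complex) \<Rightarrow> (nat \<Rightarrow> complex) \<Rightarrow> (nat \<Rightarrow> real) \<Rightarrow> nat \<Rightarrow> complex" where
  "b_asym n b l \<epsilon> I = b I * (\<Prod>i\<in>{1..n} - {I}. l I - lam_sgn (l i) (- \<epsilon> i))"

text \<open>The product of the diagonal matrices is taken on the diagonal entries.\<close>

definition D_asym :: "nat \<Rightarrow> (nat \<Rightarrow> complex) \<Rightarrow> (nat \<Rightarrow> real) \<Rightarrow> nat \<Rightarrow> mat22" where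
  "D_asym n l \<epsilon> I =
     mat2 ((- 1) ^ (n - 1) * (\<Prod>i\<in>{1..n} - {I}. lam_sgn (l i) (\<epsilon> i))) 0
          0 ((- 1) ^ (n - 1) * (\<Prod>i\<in>{1..n} - {I}. lam_sgn (l i) (- \<epsilon> i)))"

definition J_asym :: "nat \<Rightarrow> (nat \<Rightarrow> complex) \<Rightarrow> (nat \<Rightarrow> complex) \<Rightarrow> (nat \<Rightarrow> complex) \<Rightarrow>
    (nat \<Rightarrow> real) \<Rightarrow> nat \<Rightarrow> complex \<Rightarrow> mat22" where
  "J_asym n a b l \<epsilon> I L =
     (let P = Psi (a_asym n a l \<epsilon> I) (b_asym n b l \<epsilon> I) L
      in - (P ** Lam (l I) ** matrix_inv P ** D_asym n l \<epsilon> I))"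

definition phase_shift :: "nat \<Rightarrow> (nat \<Rightarrow> complex) \<Rightarrow> (nat \<Rightarrow> real) \<Rightarrow> nat \<Rightarrow> real" where
  "phase_shift n l \<epsilon> I =
     (\<Sum>i\<in>{1..n} - {I}. \<epsilon> i * ln (cmod ((l I - l i) / (l I - cnj (l i)))))"

definition sech :: "real \<Rightarrow> real" where
  "sech X = 1 / cosh X"

definition soliton_density :: "complex \<Rightarrow> complex \<Rightarrow> complex \<Rightarrow> real \<Rightarrow> complex" where
  "soliton_density \<alpha> \<beta> l X =
     8 * ((\<alpha> * cnj \<beta> - cnj \<alpha> * \<beta>) * (l - cnj l))\<^sup>2 * of_real (2 * sech X ^ 2 - 3 * sech X ^ 4)"

text \<open>Pairwise independence: the real space \<open>\<real>\<^sup>4\<close> carries at most four functions \<open>L\<^sub>i\<close> that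
  are jointly linearly independent over the complex numbers, whereas \<open>n\<close> is arbitrary.\<close>

definition mutually_independent :: "nat \<Rightarrow> (nat \<Rightarrow> real^4 \<Rightarrow> complex) \<Rightarrow> bool" where
  "mutually_independent n L \<longleftrightarrow>
     (\<forall>i\<in>{1..n}. \<forall>j\<in>{1..n}. i \<noteq> j \<longrightarrow>
        (\<forall>c d. (\<forall>x. c * L i x + d * L j x = 0) \<longrightarrow> c = 0 \<and> d = 0))"

text \<open>A resonance is a divergent phase shift. Its absence means that all logarithms in the phase
  shifts of all the solitons have arguments different from zero and infinity.\<close>

definition nonresonant :: "nat \<Rightarrow> (nat \<Rightarrow> complex) \<Rightarrow> bool" where
  "nonresonant n l \<longleftrightarrow>
     (\<forall>i\<in>{1..n}. \<forall>j\<in>{1..n}. i \<noteq> j \<longrightarrow> l i \<noteq> l j \<and> l i \<noteq> cnj (l j))"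

end

(* Lagrangian density: with N = Psi diag(1,-1) Psi^-1 the 1-soliton is J = -(h + m N) D for constants h, m
   and a constant matrix D, and N^2 = 1. Hence A_1 and A_2 are explicit polynomials in the entries of N. Since
   2 A is pure gauge along the directions d_1 + d_3 and d_2 + d_4, every F_{mu nu} reduces to a combination of
   derivatives along d_1 - d_3 and d_2 - d_4, and the trace becomes a polynomial in the product of the
   off-diagonal entries of N, which is sech^2 X.

   Asymptotics: the blocks of -(psi_1 Lambda_1^n, ..., psi_n Lambda_n^n) W^-1 are the lower coefficients of the monic
   matrix polynomial of degree n that annihilates every column of every psi_i at its eigenvalue, and J_{n+1} is
   the value of this polynomial at 0. In the limit the normalized columns of psi_i, i ~= I, become unit vectors. So
   the limit polynomial is (z + k) diag(prod (z - mu_i), prod (z - nu_i)), and the condition at lambda_I determines k.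
   The difference of the two polynomials has degree < n, hence it is controlled by its values at the nodes
   mu_i and nu_i, which are small. *)

theory Submission
  imports Defs "HOL-Computational_Algebra.Polynomial"
begin

text \<open>The obstacle is that the entries of \<open>W\<close> grow and decay at unrelated rates,
  so no limit can be taken in \<open>W\<close> or in its inverse. The annihilation conditions do not
  change when a column is rescaled: only the ratio of its two entries enters, and for i other than I
  this ratio or its reciprocal tends to 0. Smallness at the nodes is only relative, however: a
  condition bounds one entry of a row by a small ratio times the other entry, which is itself
  unknown. Interpolation bounds that entry in turn by the sum of the node values, and a small ratio
  allows this sum to be absorbed. The two conditions from psi_I form a linear system whose
  determinant stays comparable with the squared length of a column of psi_I. Hence all constants
  come from the \<lambda>_i and the signs, and are fixed before the point x. The constant factor
  \<open>D\<close> cancels in (dJ) J^-1. This is why the asymptotic form has the density of a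
  1-soliton with changed constants a and b.\<close>

section \<open>Matrices of size two\<close>

lemma mat2_component [simp]:
  "mat2 a b c d $ 1 $ 1 = a" "mat2 a b c d $ 1 $ 2 = b"
  "mat2 a b c d $ 2 $ 1 = c" "mat2 a b c d $ 2 $ 2 = d"
  by (simp_all add: mat2_def)

lemma mat22_eq_iff:
  fixes A B :: mat22
  shows "A = B \<longleftrightarrow> A$1$1 = B$1$1 \<and> A$1$2 = B$1$2 \<and> A$2$1 = B$2$1 \<and> A$2$2 = B$2$2"
  by (auto simp: vec_eq_iff forall_2)

lemma matrix_mult_component_22:
  fixes A B :: mat22
  shows "(A ** B) $ i $ j = A$i$1 * B$1$j + A$i$2 * B$2$j"
  by (simp add: matrix_matrix_mult_def sum_2)

lemma mat_1_component_22 [simp]: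
  "(mat 1 :: mat22)$1$1 = 1" "(mat 1 :: mat22)$1$2 = 0"
  "(mat 1 :: mat22)$2$1 = 0" "(mat 1 :: mat22)$2$2 = 1"
  by (simp_all add: mat_def)

lemma mat2_mult:
  "mat2 a b c d ** mat2 a' b' c' d' =
     mat2 (a*a' + b*c') (a*b' + b*d') (c*a' + d*c') (c*b' + d*d')"
  by (simp add: mat22_eq_iff matrix_mult_component_22)

lemma mat2_add: "mat2 a b c d + mat2 a' b' c' d' = mat2 (a+a') (b+b') (c+c') (d+d')"
  by (simp add: mat22_eq_iff)

lemma mat2_diff: "mat2 a b c d - mat2 a' b' c' d' = mat2 (a-a') (b-b') (c-c') (d-d')"
  by (simp add: mat22_eq_iff)

lemma mat2_uminus: "- mat2 a b c d = mat2 (-a) (-b) (-c) (-d)"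
  by (simp add: mat22_eq_iff)

lemma mat2_scaleR: "k *\<^sub>R mat2 a b c d = mat2 (k*a) (k*b) (k*c) (k*d)"
  by (simp add: mat22_eq_iff scaleR_conv_of_real[where 'a = complex])

lemma mat2_eq_iff: "mat2 a b c d = mat2 a' b' c' d' \<longleftrightarrow> a = a' \<and> b = b' \<and> c = c' \<and> d = d'"
  by (simp add: mat22_eq_iff)

lemma mat2_one: "mat 1 = mat2 1 0 0 1"
  by (simp add: mat22_eq_iff)

lemma trace_mat2: "trace (mat2 a b c d) = a + d"
  by (simp add: trace_def sum_2)

lemma matrix_inv_unique:
  fixes A B :: "'a::semiring_1^'n^'n"
  assumes "A ** B = mat 1" "B ** A = mat 1"
  shows "matrix_inv A = B"
proof -
  have "A ** matrix_inv A = mat 1 \<and> matrix_inv A ** A = mat 1"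
    unfolding matrix_inv_def by (rule someI[of _ B]) (use assms in auto)
  then show ?thesis
    by (metis assms(2) matrix_mul_assoc matrix_mul_lid matrix_mul_rid)
qed

lemma mat2_inverse:
  assumes "a*d - b*c \<noteq> 0"
  defines "B \<equiv> mat2 (d/(a*d-b*c)) (-b/(a*d-b*c)) (-c/(a*d-b*c)) (a/(a*d-b*c))"
  shows "mat2 a b c d ** B = mat 1" "B ** mat2 a b c d = mat 1"
proof -
  define w where "w = a*d - b*c"
  have "w \<noteq> 0" using assms by (simp add: w_def)
  then have *: "a * (d/w) + b * (- c/w) = 1" "c * (- b/w) + d * (a/w) = 1"
    "d/w * a + - b/w * c = 1" "- c/w * b + a/w * d = 1"
    by (simp_all add: field_simps, simp_all add: w_def algebra_simps)
  show "mat2 a b c d ** B = mat 1" "B ** mat2 a b c d = mat 1"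
    unfolding B_def mat2_mult mat2_one mat2_eq_iff w_def[symmetric] using * by auto
qed

lemma matrix_inv_mat2:
  assumes "a*d - b*c \<noteq> 0"
  shows "matrix_inv (mat2 a b c d) =
    mat2 (d/(a*d-b*c)) (-b/(a*d-b*c)) (-c/(a*d-b*c)) (a/(a*d-b*c))"
  using mat2_inverse[OF assms] by (rule matrix_inv_unique)

lemma mat2_mult_matrix_inv:
  assumes "a*d - b*c \<noteq> 0"
  shows "mat2 a b c d ** matrix_inv (mat2 a b c d) = mat 1"
  unfolding matrix_inv_mat2[OF assms] by (rule mat2_inverse(1)[OF assms])

lemma has_vector_derivative_mat2:
  assumes "(f1 has_vector_derivative d1) F" "(f2 has_vector_derivative d2) F"
    "(f3 has_vector_derivative d3) F" "(f4 has_vector_derivative d4) F"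
  shows "((\<lambda>t. mat2 (f1 t) (f2 t) (f3 t) (f4 t)) has_vector_derivative mat2 d1 d2 d3 d4) F"
proof -
  have bl: "bounded_linear (\<lambda>z. mat2 z 0 0 0)" "bounded_linear (\<lambda>z. mat2 0 z 0 0)"
    "bounded_linear (\<lambda>z. mat2 0 0 z 0)" "bounded_linear (\<lambda>z. mat2 0 0 0 z)"
    unfolding linear_conv_bounded_linear[symmetric]
    by (auto intro!: linearI simp: mat2_add mat2_scaleR scaleR_conv_of_real[where 'a = complex])
  have "((\<lambda>t. mat2 (f1 t) 0 0 0 + mat2 0 (f2 t) 0 0 + mat2 0 0 (f3 t) 0 + mat2 0 0 0 (f4 t))
     has_vector_derivative (mat2 d1 0 0 0 + mat2 0 d2 0 0 + mat2 0 0 d3 0 + mat2 0 0 0 d4)) F"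
    by (intro has_vector_derivative_add bounded_linear.has_vector_derivative[OF bl(1) assms(1)]
      bounded_linear.has_vector_derivative[OF bl(2) assms(2)]
      bounded_linear.has_vector_derivative[OF bl(3) assms(3)]
      bounded_linear.has_vector_derivative[OF bl(4) assms(4)])
  then show ?thesis
    by (simp add: mat2_add)
qed

section \<open>The 1-soliton\<close>

text \<open>\<open>soliton_norm\<close> is \<open>det \<psi>\<close>, and \<open>\<psi> diag(1,-1) \<psi>\<^sup>-\<^sup>1\<close> is the
  matrix with rows \<open>(T, -u)\<close> and \<open>(-v, -T)\<close>.\<close>

definition soliton_norm :: "complex \<Rightarrow> complex \<Rightarrow> complex \<Rightarrow> complex" where
  "soliton_norm a b L = a * exp L * (cnj a * exp (cnj L)) + b * exp (- L) * (cnj b * exp (- cnj L))"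

definition soliton_T :: "complex \<Rightarrow> complex \<Rightarrow> complex \<Rightarrow> complex" where
  "soliton_T a b L =
     (a * exp L * (cnj a * exp (cnj L)) - b * exp (- L) * (cnj b * exp (- cnj L))) / soliton_norm a b L"

definition soliton_u :: "complex \<Rightarrow> complex \<Rightarrow> complex \<Rightarrow> complex" where
  "soliton_u a b L = 2 * (a * exp L * (cnj b * exp (- cnj L))) / soliton_norm a b L"

definition soliton_v :: "complex \<Rightarrow> complex \<Rightarrow> complex \<Rightarrow> complex" where
  "soliton_v a b L = 2 * (b * exp (- L) * (cnj a * exp (cnj L))) / soliton_norm a b L"

text \<open>The second column of psi is the conjugate of the first turned by a right angle, so the
  determinant is the squared length of the first column. This makes psi invertible at every
  point.\<close>

lemma soliton_norm_eq:
  "soliton_norm a b L = of_real ((cmod (a * exp L))\<^sup>2 + (cmod (b * exp (- L)))\<^sup>2)"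
  by (simp only: soliton_norm_def of_real_add complex_norm_square complex_cnj_mult exp_cnj complex_cnj_minus)

lemma soliton_norm_nonzero:
  assumes "a \<noteq> 0"
  shows "soliton_norm a b L \<noteq> 0"
proof -
  have "(cmod (a * exp L))\<^sup>2 + (cmod (b * exp (- L)))\<^sup>2 > 0"
    using assms by (intro add_pos_nonneg) auto
  then show ?thesis unfolding soliton_norm_eq of_real_eq_0_iff by linarith
qed

text \<open>The matrix with rows \<open>(T, -u)\<close> and \<open>(-v, -T)\<close> is conjugate to
  diag(1,-1), so its determinant is -1. In terms of the entries this is (x - y)^2 + 4xy = (x +
  y)^2.\<close>

lemma soliton_uv:
  assumes "a \<noteq> 0"
  shows "(soliton_T a b L)\<^sup>2 + soliton_u a b L * soliton_v a b L = 1"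
proof -
  have *: "((x - y) / w)\<^sup>2 + (2 * (a1 * b2) / w) * (2 * (b1 * a2) / w) = 1"
    if "w = x + y" "x = a1 * a2" "y = b1 * b2" "w \<noteq> 0" for a1 a2 b1 b2 x y w :: complex
  proof -
    have "((x - y) / w)\<^sup>2 + (2 * (a1 * b2) / w) * (2 * (b1 * a2) / w) = ((x - y)\<^sup>2 + 4 * x * y) / w\<^sup>2"
      using that by (simp add: power_divide add_divide_distrib power2_eq_square)
    also have "(x - y)\<^sup>2 + 4 * x * y = w\<^sup>2"
      unfolding that(1) by (simp add: power2_eq_square algebra_simps)
    finally show ?thesis using that(4) by simp
  qed
  show ?thesis
    unfolding soliton_T_def soliton_u_def soliton_v_def
    by (rule *[OF soliton_norm_def refl refl soliton_norm_nonzero[OF assms]])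
qed

text \<open>With p = |a exp L| and q = |b exp(-L)|, the ratio p/q is exp X because X contains log
  |a/b|, and \<open>u * v\<close> is the square of 2pq/(p^2 + q^2).\<close>

lemma soliton_uv_eq:
  assumes "a \<noteq> 0" "b \<noteq> 0"
  shows "soliton_u a b L * soliton_v a b L = of_real ((sech (Xfun a b L))\<^sup>2)"
proof -
  define p where "p = cmod (a * exp L)"
  define q where "q = cmod (b * exp (- L))"
  have pq: "p > 0" "q > 0" using assms by (auto simp: p_def q_def)
  have "exp (Re (L + cnj L)) = exp (Re L) * exp (Re L)"
    by (simp flip: exp_add)
  then have X: "exp (Xfun a b L) = p / q"
    using assms
    by (simp add: Xfun_def p_def q_def exp_add norm_mult norm_divide exp_minus field_simps)
  have "cosh (Xfun a b L) = (p / q + q / p) / 2"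
    by (simp add: cosh_def X exp_minus)
  then have s: "sech (Xfun a b L) = 2 * p * q / (p\<^sup>2 + q\<^sup>2)"
    using pq by (simp add: sech_def field_simps power2_eq_square)
  have A: "a * exp L * (cnj a * exp (cnj L)) = of_real (p\<^sup>2)"
    unfolding p_def complex_norm_square by (simp add: exp_cnj)
  have B: "b * exp (- L) * (cnj b * exp (- cnj L)) = of_real (q\<^sup>2)"
    unfolding q_def complex_norm_square by (simp add: exp_cnj)
  have "soliton_u a b L * soliton_v a b L =
     4 * ((a * exp L * (cnj a * exp (cnj L))) * (b * exp (- L) * (cnj b * exp (- cnj L)))) / (soliton_norm a b L)\<^sup>2"
    unfolding soliton_u_def soliton_v_def by (simp add: field_simps power2_eq_square)
  also have "\<dots> = of_real (4 * (p\<^sup>2 * q\<^sup>2) / (p\<^sup>2 + q\<^sup>2)\<^sup>2)"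
    unfolding A B soliton_norm_eq by (simp add: p_def q_def)
  also have "4 * (p\<^sup>2 * q\<^sup>2) / (p\<^sup>2 + q\<^sup>2)\<^sup>2 = (sech (Xfun a b L))\<^sup>2"
    unfolding s by (simp add: power_divide power_mult_distrib)
  finally show ?thesis .
qed

text \<open>For nonzero b, \<open>T\<close> is tanh X, and \<open>u\<close> and \<open>v\<close> are
  sech X times phases proportional to exp(L - cnj L) and its inverse. Along a line of slope
  \<open>c\<close>, X changes at the rate \<open>c + cnj c\<close> and L - cnj L at the rate
  \<open>c - cnj c\<close>, so polynomials in \<open>T\<close>, \<open>u\<close>, \<open>v\<close>
  are closed under differentiation.\<close>

lemma soliton_derivatives:
  fixes a b L c :: complex
  assumes "a \<noteq> 0"
  defines "T \<equiv> soliton_T a b" and "u \<equiv> soliton_u a b" and "v \<equiv> soliton_v a b"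
  shows "((\<lambda>t. T (L + of_real t * c)) has_vector_derivative u L * v L * (c + cnj c)) (at 0)"
    and "((\<lambda>t. u (L + of_real t * c)) has_vector_derivative
           u L * (- T L * (c + cnj c) + (c - cnj c))) (at 0)"
    and "((\<lambda>t. v (L + of_real t * c)) has_vector_derivative
           v L * (- T L * (c + cnj c) - (c - cnj c))) (at 0)"
proof -
  \<comment> \<open>The conjugated factors are written with \<open>cnj c\<close>, which makes them
    entire functions of \<open>z\<close> that agree with the conjugates for real \<open>z\<close>.
    The rules for complex derivatives then apply, and the result is restricted to real
    \<open>t\<close>.\<close>
  define A where "A = (\<lambda>z. a * exp (L + z * c))"
  define A' where "A' = (\<lambda>z. cnj a * exp (cnj L + z * cnj c))"
  define B where "B = (\<lambda>z. b * exp (- (L + z * c)))"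
  define B' where "B' = (\<lambda>z. cnj b * exp (- (cnj L + z * cnj c)))"
  define w where "w = (\<lambda>z. A z * A' z + B z * B' z)"
  have dA: "(A has_field_derivative A 0 * c) (at 0)"
    and dA': "(A' has_field_derivative A' 0 * cnj c) (at 0)"
    and dB: "(B has_field_derivative - (B 0 * c)) (at 0)"
    and dB': "(B' has_field_derivative - (B' 0 * cnj c)) (at 0)"
    unfolding A_def A'_def B_def B'_def by (auto intro!: derivative_eq_intros)
  have w0: "w 0 \<noteq> 0"
    using soliton_norm_nonzero[OF assms(1), of b L]
    by (simp add: w_def A_def A'_def B_def B'_def soliton_norm_def)
  have dw: "(w has_field_derivative (A 0 * A' 0 - B 0 * B' 0) * (c + cnj c)) (at 0)"
    unfolding w_def
    by (rule derivative_eq_intros dA dA' dB dB' refl)+ (simp add: algebra_simps)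
  have eT: "T (L + of_real t * c) = (A (of_real t) * A' (of_real t) - B (of_real t) * B' (of_real t)) / w (of_real t)"
    and eu: "u (L + of_real t * c) = 2 * (A (of_real t) * B' (of_real t)) / w (of_real t)"
    and ev: "v (L + of_real t * c) = 2 * (B (of_real t) * A' (of_real t)) / w (of_real t)" for t :: real
    by (simp_all add: T_def u_def v_def soliton_T_def soliton_u_def soliton_v_def soliton_norm_def
        w_def A_def A'_def B_def B'_def)
  have e0: "T L = (A 0 * A' 0 - B 0 * B' 0) / w 0" "u L = 2 * (A 0 * B' 0) / w 0" "v L = 2 * (B 0 * A' 0) / w 0"
    using eT[of 0] eu[of 0] ev[of 0] by simp_all
  have w0': "A 0 * A' 0 + B 0 * B' 0 \<noteq> 0" using w0 by (simp add: w_def)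
  have "((\<lambda>z. (A z * A' z - B z * B' z) / w z) has_field_derivative u L * v L * (c + cnj c)) (at 0)"
    unfolding e0
    by (rule derivative_eq_intros dA dA' dB dB' dw refl w0)+
      (simp add: w_def w0' divide_simps, simp add: algebra_simps)
  from has_vector_derivative_real_field[where a = 0, simplified, OF this]
  show "((\<lambda>t. T (L + of_real t * c)) has_vector_derivative u L * v L * (c + cnj c)) (at 0)"
    unfolding eT .
  have "((\<lambda>z. 2 * (A z * B' z) / w z) has_field_derivative u L * (- T L * (c + cnj c) + (c - cnj c))) (at 0)"
    unfolding e0
    by (rule derivative_eq_intros dA dA' dB dB' dw refl w0)+
      (simp add: w_def w0' divide_simps, simp add: algebra_simps)
  from has_vector_derivative_real_field[where a = 0, simplified, OF this]
  show "((\<lambda>t. u (L + of_real t * c)) has_vector_derivative u L * (- T L * (c + cnj c) + (c - cnj c))) (at 0)"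
    unfolding eu .
  have "((\<lambda>z. 2 * (B z * A' z) / w z) has_field_derivative v L * (- T L * (c + cnj c) - (c - cnj c))) (at 0)"
    unfolding e0
    by (rule derivative_eq_intros dA dA' dB dB' dw refl w0)+
      (simp add: w_def w0' divide_simps, simp add: algebra_simps)
  from has_vector_derivative_real_field[where a = 0, simplified, OF this]
  show "((\<lambda>t. v (L + of_real t * c)) has_vector_derivative v L * (- T L * (c + cnj c) - (c - cnj c))) (at 0)"
    unfolding ev .
qed

text \<open>\<open>Lam l\<close> is h + m diag(1,-1), with h and m the half sum and half difference
  of \<open>l\<close> and \<open>cnj l\<close>. Conjugation by psi fixes the scalar part.\<close>

lemma Psi_conj_Lam:
  fixes a b l L :: complex
  assumes "a \<noteq> 0"
  shows "Psi a b L ** Lam l ** matrix_inv (Psi a b L) =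
    mat2 ((l + cnj l)/2 + (l - cnj l)/2 * soliton_T a b L) (- ((l - cnj l)/2 * soliton_u a b L))
         (- ((l - cnj l)/2 * soliton_v a b L)) ((l + cnj l)/2 - (l - cnj l)/2 * soliton_T a b L)"
proof -
  define A where "A = a * exp L"
  define A' where "A' = cnj a * exp (cnj L)"
  define B where "B = b * exp (- L)"
  define B' where "B' = cnj b * exp (- cnj L)"
  have P: "Psi a b L = mat2 A B' (- B) A'"
    by (simp add: Psi_def A_def A'_def B_def B'_def)
  have w: "A * A' + B * B' \<noteq> 0"
    using soliton_norm_nonzero[OF assms, of b L] by (simp add: soliton_norm_def A_def A'_def B_def B'_def)
  have e: "soliton_T a b L = (A * A' - B * B') / (A * A' + B * B')"
     "soliton_u a b L = 2 * (A * B') / (A * A' + B * B')"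
     "soliton_v a b L = 2 * (B * A') / (A * A' + B * B')"
    by (simp_all add: soliton_T_def soliton_u_def soliton_v_def soliton_norm_def A_def A'_def B_def B'_def)
  define h where "h = (l + cnj l) / 2"
  define m where "m = (l - cnj l) / 2"
  define l' where "l' = cnj l"
  have l: "l = h + m" "l' = h - m"
    by (simp_all add: h_def m_def l'_def field_simps)
  define w where "w = A * A' + B * B'"
  have w: "w \<noteq> 0" "A * A' - B' * (- B) = w"
    using w by (simp_all add: w_def)
  have d0: "A * A' - B' * (- B) \<noteq> 0" using w by simp
  show ?thesis
    unfolding P matrix_inv_mat2[OF d0] Lam_def mat2_mult mat2_eq_iff e w_def[symmetric] w(2)
      h_def[symmetric] m_def[symmetric] l'_def[symmetric]
    unfolding l using w(1) by (simp add: field_simps, simp add: w_def algebra_simps)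
qed

section \<open>Gauge fields of a soliton\<close>

lemma Lfun_add_axis:
  "Lfun \<alpha> \<beta> l (x + t *\<^sub>R axis \<mu> 1) = Lfun \<alpha> \<beta> l x + of_real t * Lfun \<alpha> \<beta> l (axis \<mu> 1)"
  by (simp add: Lfun_def field_simps)

lemma Lfun_axis:
  "Lfun \<alpha> \<beta> l (axis 1 1) = (l * \<alpha> + \<beta>) / of_real (sqrt 2)"
  "Lfun \<alpha> \<beta> l (axis 2 1) = (l * \<beta> - \<alpha>) / of_real (sqrt 2)"
  "Lfun \<alpha> \<beta> l (axis 3 1) = (l * \<alpha> - \<beta>) / of_real (sqrt 2)"
  "Lfun \<alpha> \<beta> l (axis 4 1) = (l * \<beta> + \<alpha>) / of_real (sqrt 2)"
  by (simp_all add: Lfun_def axis_def)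

lemma pderiv_dir_mat2:
  assumes "((\<lambda>t. f1 (x + t *\<^sub>R axis \<mu> 1)) has_vector_derivative d1) (at 0)"
    "((\<lambda>t. f2 (x + t *\<^sub>R axis \<mu> 1)) has_vector_derivative d2) (at 0)"
    "((\<lambda>t. f3 (x + t *\<^sub>R axis \<mu> 1)) has_vector_derivative d3) (at 0)"
    "((\<lambda>t. f4 (x + t *\<^sub>R axis \<mu> 1)) has_vector_derivative d4) (at 0)"
  shows "pderiv_dir \<mu> (\<lambda>y. mat2 (f1 y) (f2 y) (f3 y) (f4 y)) x = mat2 d1 d2 d3 d4"
  unfolding pderiv_dir_def
  by (rule vector_derivative_at has_vector_derivative_mat2 assms)+

section \<open>Curvature, density and explicit gauge fields\<close>

lemma field_strength_up_split:
  "field_strength_up A \<mu> \<nu> x = (split_metric \<mu> \<mu> * split_metric \<nu> \<nu>) *\<^sub>R field_strength A \<mu> \<nu> x"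
proof -
  have "field_strength_up A \<mu> \<nu> x =
    (\<Sum>\<rho>\<in>UNIV. \<Sum>\<sigma>\<in>UNIV. if \<sigma> = \<nu> then if \<rho> = \<mu> then
       (split_metric \<mu> \<mu> * split_metric \<nu> \<nu>) *\<^sub>R field_strength A \<mu> \<nu> x else 0 else 0)"
    unfolding field_strength_up_def by (intro sum.cong refl) (auto simp: split_metric_def)
  then show ?thesis by (simp add: sum.delta)
qed

lemma field_strength_antisym: "field_strength A \<nu> \<mu> x = - field_strength A \<mu> \<nu> x"
  by (simp add: field_strength_def)

lemma trace_uminus_square: "trace ((- A) ** (- A)) = trace (A ** (A :: mat22))"
  by (simp add: matrix_mult_component_22 trace_def sum_2)

text \<open>Each unordered pair of indices counts twice, and its sign is plus exactly when both
  indices lie in {1,2} or both in {3,4}.\<close>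

lemma lagrangian_density_expand:
  fixes J x
  defines "F \<equiv> \<lambda>\<mu> \<nu>. field_strength (gauge_field J) \<mu> \<nu> x"
  defines "q \<equiv> \<lambda>\<mu> \<nu>. trace (F \<mu> \<nu> ** F \<mu> \<nu>)"
  shows "lagrangian_density J x = 2 * (q 1 2 + q 3 4 - q 1 3 - q 1 4 - q 2 3 - q 2 4)"
proof -
  have tr: "trace (A ** (k *\<^sub>R B)) = of_real k * trace (A ** B)" for A B :: mat22 and k
    by (simp add: trace_def sum_2 matrix_mult_component_22 scaleR_conv_of_real[where 'a = complex] algebra_simps)
  have q: "q \<nu> \<mu> = q \<mu> \<nu>" for \<mu> \<nu>
    unfolding q_def F_def field_strength_antisym[of _ \<nu> \<mu>] trace_uminus_square ..
  have q0: "q \<mu> \<mu> = 0" for \<mu>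
    by (simp add: q_def F_def field_strength_def trace_def sum_2 matrix_mult_component_22)
  have "lagrangian_density J x =
     (\<Sum>\<mu>\<in>UNIV. \<Sum>\<nu>\<in>UNIV. of_real (split_metric \<mu> \<mu> * split_metric \<nu> \<nu>) * q \<mu> \<nu>)"
    unfolding lagrangian_density_def Let_def field_strength_up_split q_def F_def
    by (simp add: trace_add tr sum_4)
  also have "\<dots> = 2 * (q 1 2 + q 3 4 - q 1 3 - q 1 4 - q 2 3 - q 2 4)"
    using q[of 2 1] q[of 3 1] q[of 4 1] q[of 3 2] q[of 4 2] q[of 4 3]
    by (simp add: sum_4 q0 split_metric_def)
  finally show ?thesis .
qed

text \<open>The closed form of the gauge fields. With \<open>c = - (r * m)\<close> and r the square
  root of 2, it is A_1 if p and q are the real and the imaginary part of \<alpha> (so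
  \<open>p + q = \<alpha>\<close>), and A_2 if they are those of \<beta>.\<close>

definition gauge_mat :: "complex \<Rightarrow> complex \<Rightarrow> complex \<Rightarrow> complex \<Rightarrow> complex \<Rightarrow> complex \<Rightarrow> mat22" where
  "gauge_mat c p q T u v = mat2 (c * p * u * v) (c * u * (p * T - q)) (c * v * (p * T + q)) (- (c * p * u * v))"

text \<open>Derivative of \<open>gauge_mat\<close> in a direction where \<open>X\<close> and
  \<open>\<Theta>\<close> are the rates of change of X and of L - cnj L. It is linear in this pair,
  so sums and differences of derivatives keep the form.\<close>

definition gauge_mat_deriv ::
  "complex \<Rightarrow> complex \<Rightarrow> complex \<Rightarrow> complex \<Rightarrow> complex \<Rightarrow> complex \<Rightarrow> complex \<Rightarrow> complex \<Rightarrow> mat22" where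
  "gauge_mat_deriv c p q X \<Theta> T u v =
     mat2 (- (2 * c * p * T * u * v * X))
       (c * u * ((\<Theta> - T * X) * (p * T - q) + p * u * v * X))
       (c * v * ((- \<Theta> - T * X) * (p * T + q) + p * u * v * X))
       (2 * c * p * T * u * v * X)"

text \<open>Integrability of D J = - 2 A J for the commuting derivatives d_1 + d_3 and d_2 + d_4.
  The commutator has the factor -2 because the flat connection is 2 A, not A. As a polynomial
  identity modulo the two hypotheses it involves no second derivatives of J.\<close>

lemma gauge_mat_zero_curvature:
  fixes T u v r m h p1 q1 p2 q2 :: complex
  assumes "T\<^sup>2 + u * v = 1" "r\<^sup>2 = 2"
  defines "c \<equiv> - (r * m)"
  defines "P \<equiv> gauge_mat c p1 q1 T u v" and "Q \<equiv> gauge_mat c p2 q2 T u v"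
  shows "gauge_mat_deriv c p2 q2 (2*r*(h*p1 + m*q1)) (2*r*(h*q1 + m*p1)) T u v
     - gauge_mat_deriv c p1 q1 (2*r*(h*p2 + m*q2)) (2*r*(h*q2 + m*p2)) T u v
     = - 2 *\<^sub>R (P ** Q - Q ** P)"
  unfolding P_def Q_def gauge_mat_def gauge_mat_deriv_def mat2_mult mat2_diff mat2_scaleR mat2_eq_iff c_def
proof (intro conjI)
  show "- (2 * (- (r * m)) * p2 * T * u * v * (2 * r * (h * p1 + m * q1))) -
     - (2 * (- (r * m)) * p1 * T * u * v * (2 * r * (h * p2 + m * q2))) =
     of_real (- 2) * (- (r * m) * p1 * u * v * (- (r * m) * p2 * u * v) +
       - (r * m) * u * (p1 * T - q1) * (- (r * m) * v * (p2 * T + q2)) -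
      (- (r * m) * p2 * u * v * (- (r * m) * p1 * u * v) +
       - (r * m) * u * (p2 * T - q2) * (- (r * m) * v * (p1 * T + q1))))"
    by (simp add: algebra_simps)
qed (use assms(1,2) in \<open>(simp, algebra)+\<close>, simp add: algebra_simps)

text \<open>The equation D J = - 2 A J that determines A, in a form without the inverse of J. The
  two summands on the left are the two partial derivatives in D. Since \<open>d1\<close> and
  \<open>d2\<close> scale the columns on both sides, A does not depend on them.\<close>

lemma gauge_mat_mult_soliton:
  fixes T u v r m h p q z d1 d2 X X' \<Theta> \<Theta>' :: complex
  assumes "T * T = 1 - u * v"
    and X: "X + X' = 2 * r * (h * p + m * q)" and \<Theta>: "\<Theta> + \<Theta>' = 2 * r * (h * q + m * p)"
  shows "mat2 (- m * (u * v * X) * d1) (m * (u * (- T * X + \<Theta>)) * d2)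
        (m * (v * (- T * X - \<Theta>)) * d1) (m * (u * v * X) * d2) +
      mat2 (- m * (u * v * X') * d1) (m * (u * (- T * X' + \<Theta>')) * d2)
        (m * (v * (- T * X' - \<Theta>')) * d1) (m * (u * v * X') * d2) =
     - 2 *\<^sub>R (gauge_mat (- (r * m)) p q T u v **
        mat2 (- (h + m * T) * d1) (m * u * d2) (m * v * d1) (- (h - m * T) * d2))"
proof -
  have "- m * (u * v * X) * d1 + - m * (u * v * X') * d1 = - m * u * v * d1 * (X + X')"
    "m * (u * (- T * X + \<Theta>)) * d2 + m * (u * (- T * X' + \<Theta>')) * d2 = m * u * d2 * ((\<Theta> + \<Theta>') - T * (X + X'))"
    "m * (v * (- T * X - \<Theta>)) * d1 + m * (v * (- T * X' - \<Theta>')) * d1 = - m * v * d1 * ((\<Theta> + \<Theta>') + T * (X + X'))"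
    "m * (u * v * X) * d2 + m * (u * v * X') * d2 = m * u * v * d2 * (X + X')"
    by (simp_all add: algebra_simps)
  note sums = this
  have TT: "T * (T * z) = z - u * (v * z)" for z
    unfolding mult.assoc[symmetric] assms(1) by (simp add: algebra_simps)
  show ?thesis
    unfolding mat2_add sums X \<Theta>
    unfolding gauge_mat_def mat2_mult mat2_scaleR mat2_eq_iff
    by (simp add: TT algebra_simps)
qed

text \<open>The left side is the density after elimination of the commutators. Up to sign, the half
  sum is F_12 and F_34, the half difference is F_14 and F_23, and the last two matrices are F_13 and
  F_24.\<close>

lemma gauge_mat_trace_identity:
  fixes T u v r m p1 q1 p2 q2 :: complex
  assumes "T\<^sup>2 + u * v = 1" "r\<^sup>2 = 2"
  defines "c \<equiv> - (r * m)"
  defines "M \<equiv> \<lambda>p q X \<Theta>. gauge_mat_deriv c p q (2*r*X) (2*r*\<Theta>) T u v"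
  defines "S \<equiv> \<lambda>A :: mat22. trace (A ** A)"
  shows "2 * (2 * S ((1/2) *\<^sub>R (M p2 q2 p2 q2 + M p1 q1 p1 q1)) - 2 * S ((1/2) *\<^sub>R (M p2 q2 p2 q2 - M p1 q1 p1 q1))
      - S (M p1 q1 p2 q2) - S (M p2 q2 p1 q1))
     = 8 * (2 * (q1 * p2 - p1 * q2) * (2 * m))\<^sup>2 * (2 * (u * v) - 3 * (u * v)\<^sup>2)"
proof -
  define w where "w = u * v"
  have T2: "T * T = 1 - w"
    using assms(1) by (simp add: w_def power2_eq_square algebra_simps)
  \<comment> \<open>\<open>2 * r\<close> is the common factor of the rates and \<open>c\<close> that
    of the gauge field; since r^2 = 2, this is -4m.\<close>
  define k where "k = 2 * r * c"
  have k2: "k * k = 16 * m * m"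
  proof -
    have "k = - (2 * r\<^sup>2 * m)" by (simp add: k_def c_def power2_eq_square)
    then show ?thesis using assms(2) by simp
  qed
  \<comment> \<open>Divided by \<open>k * u\<close> and \<open>k * v\<close>, the off-diagonal
    entries are \<open>g + T * f\<close> and \<open>g - T * f\<close>. Hence the symmetrized trace
    has no odd powers of \<open>T\<close>, and T^2 = 1 - w leaves a polynomial in
    \<open>w\<close>.\<close>
  define g where "g = (\<lambda>p q X \<Theta> :: complex. 2 * p * X * w - (\<Theta> * q + p * X))"
  define f where "f = (\<lambda>p q X \<Theta> :: complex. \<Theta> * p + X * q)"
  define N where "N = (\<lambda>p q X \<Theta>. mat2 (k * (- (2 * p * X * w) * T)) (k * (u * (g p q X \<Theta> + T * f p q X \<Theta>)))
       (k * (v * (g p q X \<Theta> - T * f p q X \<Theta>))) (- (k * (- (2 * p * X * w) * T))))"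
  define B where "B = (\<lambda>p q X \<Theta> p' q' X' \<Theta>'.
     32 * m * m * (4 * p * X * w * p' * X' * w * (1 - w)
         + w * (g p q X \<Theta> * g p' q' X' \<Theta>' - (1 - w) * f p q X \<Theta> * f p' q' X' \<Theta>')))"
  have M: "M = N"
  proof (intro ext)
    fix p q X \<Theta>
    have "(\<Theta> - T * X) * (p * T - q) + p * u * v * X = g p q X \<Theta> + T * f p q X \<Theta>"
      "(- \<Theta> - T * X) * (p * T + q) + p * u * v * X = g p q X \<Theta> - T * f p q X \<Theta>"
      unfolding g_def f_def w_def[symmetric] mult.assoc[of p u v] using T2 by algebra+
    note * = this
    have "(2*r*\<Theta> - T * (2*r*X)) * (p * T - q) + p * u * v * (2*r*X) = 2 * r * (g p q X \<Theta> + T * f p q X \<Theta>)"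
       "(- (2*r*\<Theta>) - T * (2*r*X)) * (p * T + q) + p * u * v * (2*r*X) = 2 * r * (g p q X \<Theta> - T * f p q X \<Theta>)"
      unfolding *[symmetric] by (simp_all add: algebra_simps)
    note ** = this
    show "M p q X \<Theta> = N p q X \<Theta>"
      unfolding M_def N_def gauge_mat_deriv_def ** mat2_eq_iff k_def w_def by (simp add: algebra_simps)
  qed
  have tr: "trace (N p q X \<Theta> ** N p' q' X' \<Theta>') + trace (N p' q' X' \<Theta>' ** N p q X \<Theta>) = 2 * B p q X \<Theta> p' q' X' \<Theta>'"
    for p q X \<Theta> p' q' X' \<Theta>'
  proof -
    have "trace (N p q X \<Theta> ** N p' q' X' \<Theta>') + trace (N p' q' X' \<Theta>' ** N p q X \<Theta>) =
       4 * (k * k) * (4 * p * X * w * p' * X' * w * (T * T)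
         + u * v * (g p q X \<Theta> * g p' q' X' \<Theta>' - (T * T) * f p q X \<Theta> * f p' q' X' \<Theta>'))"
      unfolding N_def mat2_mult trace_mat2 by (simp add: algebra_simps)
    then show ?thesis unfolding k2 T2 B_def w_def by simp
  qed
  \<comment> \<open>Polarization: of the squares of the half sum and half difference only the mixed
    trace survives.\<close>
  have polar: "S ((1/2) *\<^sub>R (A + C)) - S ((1/2) *\<^sub>R (A - C)) = (trace (A ** C) + trace (C ** A)) / 2" for A C
    unfolding S_def
    by (simp add: trace_def sum_2 matrix_mult_component_22 scaleR_conv_of_real[where 'a = complex] field_simps)
  have SN: "S (N p q X \<Theta>) = B p q X \<Theta> p q X \<Theta>" for p q X \<Theta>
    using tr[of p q X \<Theta> p q X \<Theta>] by (simp add: S_def)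
  have "2 * S ((1/2) *\<^sub>R (M p2 q2 p2 q2 + M p1 q1 p1 q1)) - 2 * S ((1/2) *\<^sub>R (M p2 q2 p2 q2 - M p1 q1 p1 q1))
    = 2 * B p2 q2 p2 q2 p1 q1 p1 q1"
    using polar[of "N p2 q2 p2 q2" "N p1 q1 p1 q1"] unfolding tr M by (simp add: algebra_simps)
  then show ?thesis
    unfolding M SN w_def[symmetric]
    by (simp add: B_def g_def f_def, simp add: algebra_simps power2_eq_square)
qed

section \<open>Density of a soliton with a constant right factor\<close>

lemma matrix_add_rdistrib: "(A + B) ** C = A ** C + B ** C"
  by (simp add: matrix_matrix_mult_def vec_eq_iff algebra_simps sum.distrib)

lemma matrix_scaleR_mult:
  "(k *\<^sub>R A) ** C = k *\<^sub>R (A ** (C :: 'a::real_algebra_1^'n^'m))"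
  by (simp add: matrix_matrix_mult_def vec_eq_iff scaleR_sum_right)

text \<open>The diagonal right factor is general so that the statement covers both the 1-soliton,
  with both entries 1, and the asymptotic form. Its entries and \<open>l\<close> are nonzero to make
  J invertible.\<close>

lemma lagrangian_density_soliton:
  fixes a b \<alpha> \<beta> l d1 d2 :: complex
  assumes nz: "a \<noteq> 0" "b \<noteq> 0" "l \<noteq> 0" "d1 \<noteq> 0" "d2 \<noteq> 0"
  defines "L \<equiv> Lfun \<alpha> \<beta> l"
  defines "J \<equiv> \<lambda>y. - (Psi a b (L y) ** Lam l ** matrix_inv (Psi a b (L y)) ** mat2 d1 0 0 d2)"
  shows "lagrangian_density J x = soliton_density \<alpha> \<beta> l (Xfun a b (L x))"
proof -
  define T where "T = (\<lambda>y. soliton_T a b (L y))"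
  define u where "u = (\<lambda>y. soliton_u a b (L y))"
  define v where "v = (\<lambda>y. soliton_v a b (L y))"
  define C where "C = (\<lambda>\<mu>. Lfun \<alpha> \<beta> l (axis \<mu> 1))"
  define X where "X = (\<lambda>\<mu>. C \<mu> + cnj (C \<mu>))"
  define \<Theta> where "\<Theta> = (\<lambda>\<mu>. C \<mu> - cnj (C \<mu>))"
  define h where "h = (l + cnj l) / 2"
  define m where "m = (l - cnj l) / 2"
  define p1 where "p1 = (\<alpha> + cnj \<alpha>) / 2"
  define q1 where "q1 = (\<alpha> - cnj \<alpha>) / 2"
  define p2 where "p2 = (\<beta> + cnj \<beta>) / 2"
  define q2 where "q2 = (\<beta> - cnj \<beta>) / 2"
  define r where "r = complex_of_real (sqrt 2)"
  define c where "c = - (r * m)"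
  have r2: "r\<^sup>2 = 2" unfolding r_def by (simp flip: of_real_power)
  then have r0: "r \<noteq> 0" by auto
  have split: "l = h + m" "cnj l = h - m" "\<alpha> = p1 + q1" "cnj \<alpha> = p1 - q1" "\<beta> = p2 + q2" "cnj \<beta> = p2 - q2"
    by (simp_all add: h_def m_def p1_def q1_def p2_def q2_def field_simps)
  have cnjC: "cnj (C 1) = (cnj l * cnj \<alpha> + cnj \<beta>) / r" "cnj (C 2) = (cnj l * cnj \<beta> - cnj \<alpha>) / r"
     "cnj (C 3) = (cnj l * cnj \<alpha> - cnj \<beta>) / r" "cnj (C 4) = (cnj l * cnj \<beta> + cnj \<alpha>) / r"
    by (simp_all add: C_def Lfun_axis r_def)
  have C: "C 1 = (l * \<alpha> + \<beta>) / r" "C 2 = (l * \<beta> - \<alpha>) / r"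
     "C 3 = (l * \<alpha> - \<beta>) / r" "C 4 = (l * \<beta> + \<alpha>) / r"
    by (simp_all add: C_def Lfun_axis r_def)
  have inv_r: "z / r = r * z / 2" for z
    using r0 r2 by (simp add: field_simps power2_eq_square)
  have X: "X 1 = r * (h*p1 + m*q1 + p2)" "X 2 = r * (h*p2 + m*q2 - p1)"
     "X 3 = r * (h*p1 + m*q1 - p2)" "X 4 = r * (h*p2 + m*q2 + p1)"
    and \<Theta>: "\<Theta> 1 = r * (h*q1 + m*p1 + q2)" "\<Theta> 2 = r * (h*q2 + m*p2 - q1)"
     "\<Theta> 3 = r * (h*q1 + m*p1 - q2)" "\<Theta> 4 = r * (h*q2 + m*p2 + q1)"
    unfolding X_def \<Theta>_def cnjC unfolding C inv_r split(2,4,6) unfolding split(1,3,5)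
    by (simp_all add: field_simps)
  have Tuv: "(T y)\<^sup>2 + u y * v y = 1" for y
    unfolding T_def u_def v_def by (rule soliton_uv[OF nz(1)])
  have Tuv': "T y * T y = 1 - u y * v y" for y
    using Tuv[of y] by (simp add: power2_eq_square algebra_simps)
  have shift: "L (y + t *\<^sub>R axis \<mu> 1) = L y + of_real t * C \<mu>" for y t \<mu>
    by (simp add: L_def C_def Lfun_add_axis)
  have dT: "((\<lambda>t. T (y + t *\<^sub>R axis \<mu> 1)) has_vector_derivative u y * v y * X \<mu>) (at 0)"
    and du: "((\<lambda>t. u (y + t *\<^sub>R axis \<mu> 1)) has_vector_derivative u y * (- T y * X \<mu> + \<Theta> \<mu>)) (at 0)"
    and dv: "((\<lambda>t. v (y + t *\<^sub>R axis \<mu> 1)) has_vector_derivative v y * (- T y * X \<mu> - \<Theta> \<mu>)) (at 0)"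
    for y \<mu>
    unfolding T_def u_def v_def shift X_def \<Theta>_def by (rule soliton_derivatives[OF nz(1)])+
  have J: "J = (\<lambda>y. mat2 (- (h + m * T y) * d1) (m * u y * d2) (m * v y * d1) (- (h - m * T y) * d2))"
    unfolding J_def Psi_conj_Lam[OF nz(1)] mat2_mult mat2_uminus mat2_eq_iff T_def u_def v_def h_def m_def fun_eq_iff
    by (simp add: algebra_simps)
  have dJ: "pderiv_dir \<mu> J y = mat2 (- m * (u y * v y * X \<mu>) * d1) (m * (u y * (- T y * X \<mu> + \<Theta> \<mu>)) * d2)
        (m * (v y * (- T y * X \<mu> - \<Theta> \<mu>)) * d1) (m * (u y * v y * X \<mu>) * d2)" for y \<mu>
    unfolding J
    by (intro pderiv_dir_mat2; (rule derivative_eq_intros dT du dv refl)+; simp)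
  have Jinv: "J y ** matrix_inv (J y) = mat 1" for y
  proof -
    have "(- (h + m * T y) * d1) * (- (h - m * T y) * d2) - (m * u y * d2) * (m * v y * d1) = (l * cnj l) * d1 * d2"
      unfolding split(2) unfolding split(1) using Tuv'[of y] by algebra
    then show ?thesis unfolding J using nz by (intro mat2_mult_matrix_inv) simp
  qed
  define G where "G = (\<lambda>p q y. gauge_mat c p q (T y) (u y) (v y))"
  define M where "M = (\<lambda>p q X \<Theta>. gauge_mat_deriv c p q X \<Theta> (T x) (u x) (v x))"
  have GJ: "pderiv_dir 1 J y + pderiv_dir 3 J y = - 2 *\<^sub>R (G p1 q1 y ** J y)"
    "pderiv_dir 2 J y + pderiv_dir 4 J y = - 2 *\<^sub>R (G p2 q2 y ** J y)" for y
    unfolding dJ unfolding J G_def c_def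
    by (rule gauge_mat_mult_soliton[OF Tuv']; simp add: X \<Theta> algebra_simps)+
  have B: "(- 1 / 2) *\<^sub>R (P ** matrix_inv (J y) + Q ** matrix_inv (J y)) = R"
    if "P + Q = - 2 *\<^sub>R (R ** J y)" for P Q R y
  proof -
    have "P ** matrix_inv (J y) + Q ** matrix_inv (J y) = - 2 *\<^sub>R (R ** J y ** matrix_inv (J y))"
      unfolding matrix_add_rdistrib[symmetric] that by (rule matrix_scaleR_mult)
    also have "\<dots> = - 2 *\<^sub>R R"
      by (simp add: matrix_mul_assoc[symmetric] Jinv)
    finally show ?thesis by simp
  qed
  have A: "gauge_field J \<mu> = (if \<mu> = 1 \<or> \<mu> = 3 then G p1 q1 else G p2 q2)" for \<mu>
    unfolding gauge_field_def Let_def using B[OF GJ(1)] B[OF GJ(2)] by (auto simp: fun_eq_iff)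
  have dG: "pderiv_dir \<mu> (G p q) x = M p q (X \<mu>) (\<Theta> \<mu>)" for p q \<mu>
    unfolding G_def M_def gauge_mat_def gauge_mat_deriv_def
    by (intro pderiv_dir_mat2; (rule derivative_eq_intros dT du dv refl)+; simp add: algebra_simps)
  define K where "K = G p1 q1 x ** G p2 q2 x - G p2 q2 x ** G p1 q1 x"
  have lin: "M p q X \<Theta> + M p q X' \<Theta>' = M p q (X + X') (\<Theta> + \<Theta>')"
     "M p q X \<Theta> - M p q X' \<Theta>' = M p q (X - X') (\<Theta> - \<Theta>')"for p q X \<Theta> X' \<Theta>'
    unfolding M_def gauge_mat_deriv_def mat2_add mat2_diff mat2_eq_iff by (simp_all add: algebra_simps)
  have zc: "(M p2 q2 (X 1) (\<Theta> 1) + M p2 q2 (X 3) (\<Theta> 3)) - (M p1 q1 (X 2) (\<Theta> 2) + M p1 q1 (X 4) (\<Theta> 4)) = - 2 *\<^sub>R K"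
  proof -
    have "X 1 + X 3 = 2*r*(h*p1 + m*q1)" "\<Theta> 1 + \<Theta> 3 = 2*r*(h*q1 + m*p1)"
      "X 2 + X 4 = 2*r*(h*p2 + m*q2)" "\<Theta> 2 + \<Theta> 4 = 2*r*(h*q2 + m*p2)"
      unfolding X \<Theta> by (simp_all add: algebra_simps)
    note sums = this
    show ?thesis
      unfolding lin sums K_def G_def unfolding c_def M_def by (rule gauge_mat_zero_curvature[OF Tuv r2])
  qed
  \<comment> \<open>The mixed field strengths below contain the commutator once, up to sign, whereas
    flatness expresses twice the commutator. So half of each sum of derivatives is removed and half
    of the difference remains.\<close>
  have K: "K = (1/2) *\<^sub>R (M p1 q1 (X 2) (\<Theta> 2) + M p1 q1 (X 4) (\<Theta> 4)) - (1/2) *\<^sub>R (M p2 q2 (X 1) (\<Theta> 1) + M p2 q2 (X 3) (\<Theta> 3))"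
  proof -
    have "K = (- 1/2) *\<^sub>R (- 2 *\<^sub>R K)" by simp
    then show ?thesis unfolding zc[symmetric] by (simp add: algebra_simps)
  qed
  define E where "E = (\<lambda>p q X \<Theta>. gauge_mat_deriv (- (r * m)) p q (2*r*X) (2*r*\<Theta>) (T x) (u x) (v x))"
  have E1: "M p q (X 1) (\<Theta> 1) - M p q (X 3) (\<Theta> 3) = E p q p2 q2" for p q
    unfolding lin X \<Theta> unfolding M_def E_def c_def by (simp add: algebra_simps)
  have E2: "M p q (X 4) (\<Theta> 4) - M p q (X 2) (\<Theta> 2) = E p q p1 q1" for p q
    unfolding lin X \<Theta> unfolding M_def E_def c_def by (simp add: algebra_simps)
  let ?F = "\<lambda>\<mu> \<nu>. field_strength (gauge_field J) \<mu> \<nu> x"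
  \<comment> \<open>A_1 = A_3 and A_2 = A_4, so the commutators vanish in these two
    components.\<close>
  have F13: "?F 1 3 = E p1 q1 p2 q2"
    unfolding field_strength_def A E1[symmetric] by (simp add: dG)
  have F24: "?F 2 4 = - E p2 q2 p1 q1"
    unfolding field_strength_def A E2[symmetric] by (simp add: dG)
  have F: "?F 1 2 = M p2 q2 (X 1) (\<Theta> 1) - M p1 q1 (X 2) (\<Theta> 2) + K"
     "?F 1 4 = M p2 q2 (X 1) (\<Theta> 1) - M p1 q1 (X 4) (\<Theta> 4) + K"
     "?F 2 3 = - (M p2 q2 (X 3) (\<Theta> 3) - M p1 q1 (X 2) (\<Theta> 2) + K)"
     "?F 3 4 = M p2 q2 (X 3) (\<Theta> 3) - M p1 q1 (X 4) (\<Theta> 4) + K"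
    unfolding field_strength_def A K_def by (simp_all add: dG)
  have ident: "z1 - w1 + ((1/2) *\<^sub>R (w1 + w2) - (1/2) *\<^sub>R (z1 + z2)) = (1/2) *\<^sub>R ((z1 - z2) + (w2 - w1))"
     "z1 - w2 + ((1/2) *\<^sub>R (w1 + w2) - (1/2) *\<^sub>R (z1 + z2)) = (1/2) *\<^sub>R ((z1 - z2) - (w2 - w1))"
     "z2 - w1 + ((1/2) *\<^sub>R (w1 + w2) - (1/2) *\<^sub>R (z1 + z2)) = - ((1/2) *\<^sub>R ((z1 - z2) - (w2 - w1)))"
     "z2 - w2 + ((1/2) *\<^sub>R (w1 + w2) - (1/2) *\<^sub>R (z1 + z2)) = - ((1/2) *\<^sub>R ((z1 - z2) + (w2 - w1)))"
    for z1 z2 w1 w2 :: mat22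
    by (simp_all add: mat22_eq_iff scaleR_conv_of_real[where 'a = complex] field_simps)
  have abc: "2 * (s + s - f - t - t - g) = 2 * (2 * s - 2 * t - f - g)" for s t f g :: complex
    by (simp add: algebra_simps)
  have "lagrangian_density J x = 8 * (2 * (q1 * p2 - p1 * q2) * (2 * m))\<^sup>2 * (2 * (u x * v x) - 3 * (u x * v x)\<^sup>2)"
    unfolding lagrangian_density_expand F13 F24 F K ident E1 E2 trace_uminus_square abc
    unfolding E_def by (rule gauge_mat_trace_identity[OF Tuv r2])
  also have "2 * (q1 * p2 - p1 * q2) = \<alpha> * cnj \<beta> - cnj \<alpha> * \<beta>"
    unfolding split(4,6) unfolding split(3,5) by (simp add: algebra_simps)
  also have "2 * m = l - cnj l"
    by (simp add: m_def)
  also have "u x * v x = of_real ((sech (Xfun a b (L x)))\<^sup>2)"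
    unfolding u_def v_def by (rule soliton_uv_eq[OF nz(1,2)])
  finally show ?thesis
    by (simp add: soliton_density_def flip: power_mult)
qed

section \<open>Interpolation estimates\<close>

lemma lagrange_interpolation:
  fixes f :: "'a::field poly" and \<mu> :: "'b \<Rightarrow> 'a"
  assumes "finite S" "inj_on \<mu> S" "degree f < card S"
  shows "poly f z = (\<Sum>i\<in>S. poly f (\<mu> i) * (\<Prod>j\<in>S - {i}. (z - \<mu> j) / (\<mu> i - \<mu> j)))"
proof -
  define B where "B = (\<lambda>i. \<Prod>j\<in>S - {i}. smult (1 / (\<mu> i - \<mu> j)) [:- \<mu> j, 1:])"
  define g where "g = (\<Sum>i\<in>S. smult (poly f (\<mu> i)) (B i))"
  have B: "poly (B i) z = (\<Prod>j\<in>S - {i}. (z - \<mu> j) / (\<mu> i - \<mu> j))" for i z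
    by (simp add: B_def poly_prod diff_divide_distrib)
  have "degree (B i) \<le> card S - 1" if "i \<in> S" for i
  proof -
    have "degree (B i) \<le> (\<Sum>j\<in>S - {i}. degree (smult (1 / (\<mu> i - \<mu> j)) [:- \<mu> j, 1:]))"
      unfolding B_def using assms(1) by (intro order.trans[OF degree_prod_sum_le]) auto
    also have "\<dots> \<le> (\<Sum>j\<in>S - {i}. 1)" by (intro sum_mono) auto
    finally show ?thesis using that assms(1) by simp
  qed
  then have "degree g \<le> card S - 1"
    unfolding g_def using assms(1) by (intro degree_sum_le) (auto intro: order.trans[OF degree_smult_le])
  then have dg: "degree g < card S" using assms(3) by linarith
  have "poly g (\<mu> k) = poly f (\<mu> k)" if k: "k \<in> S" for k
  proof -
    have "poly (B i) (\<mu> k) = (if i = k then 1 else 0)" if i: "i \<in> S" for i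
    proof (cases "i = k")
      case True
      have "(\<mu> k - \<mu> j) / (\<mu> k - \<mu> j) = 1" if "j \<in> S - {k}" for j
        using that k assms(2) by (auto dest: inj_onD)
      then show ?thesis using True by (simp add: B)
    next
      case False
      then show ?thesis using k assms(1) by (auto simp: B intro!: prod_zero)
    qed
    then have "poly g (\<mu> k) = (\<Sum>i\<in>S. if i = k then poly f (\<mu> k) else 0)"
      unfolding g_def poly_sum by (intro sum.cong) auto
    then show ?thesis
      using k assms(1) by simp
  qed
  then have "f = g"
    using assms(3) dg card_image[OF assms(2)] by (intro poly_eqI_degree[of "\<mu> ` S"]) auto
  then have "poly f z = poly g z" by simp
  then show ?thesis by (simp add: g_def poly_sum B)
qed

text \<open>Lagrange interpolation at \<kappa> and the \<mu>_i. The term of \<kappa> is the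
  subtracted multiple of the product; the others are node values times basis values at
  \<open>z\<close>, which do not depend on \<open>f\<close>.\<close>

lemma poly_node_estimate:
  fixes \<mu> :: "'b \<Rightarrow> complex"
  assumes "finite K" "inj_on \<mu> K" "\<kappa> \<notin> \<mu> ` K"
  shows "\<exists>C\<ge>0. \<forall>f. degree f \<le> card K \<longrightarrow>
    cmod (poly f z - poly f \<kappa> / (\<Prod>i\<in>K. \<kappa> - \<mu> i) * (\<Prod>i\<in>K. z - \<mu> i)) \<le> C * (\<Sum>i\<in>K. cmod (poly f (\<mu> i)))"
proof -
  \<comment> \<open>The extra node \<kappa> gets the index \<open>None\<close>, which no element of
    \<open>K\<close> can occupy.\<close>
  define S where "S = insert None (Some ` K)"
  define \<eta> where "\<eta> = case_option \<kappa> \<mu>"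
  define b where "b = (\<lambda>i. \<Prod>j\<in>S - {i}. (z - \<eta> j) / (\<eta> i - \<eta> j))"
  have S: "finite S" "inj_on \<eta> S" "card S = card K + 1"
    using assms by (auto simp: S_def \<eta>_def inj_on_def card_image)
  have "S - {None} = Some ` K" by (auto simp: S_def)
  then have bN: "b None = (\<Prod>i\<in>K. z - \<mu> i) / (\<Prod>i\<in>K. \<kappa> - \<mu> i)"
    by (simp add: b_def prod.reindex prod_dividef \<eta>_def)
  have "cmod (poly f z - poly f \<kappa> / (\<Prod>i\<in>K. \<kappa> - \<mu> i) * (\<Prod>i\<in>K. z - \<mu> i))
      \<le> (\<Sum>i\<in>K. cmod (b (Some i))) * (\<Sum>i\<in>K. cmod (poly f (\<mu> i)))" if f: "degree f \<le> card K" for f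
  proof -
    have "poly f z = (\<Sum>i\<in>S. poly f (\<eta> i) * b i)"
      unfolding b_def using S f by (intro lagrange_interpolation) auto
    also have "\<dots> = poly f \<kappa> * b None + (\<Sum>i\<in>K. poly f (\<mu> i) * b (Some i))"
      unfolding S_def using assms(1) by (subst sum.insert) (auto simp: sum.reindex \<eta>_def)
    finally have "poly f z - poly f \<kappa> / (\<Prod>i\<in>K. \<kappa> - \<mu> i) * (\<Prod>i\<in>K. z - \<mu> i) = (\<Sum>i\<in>K. poly f (\<mu> i) * b (Some i))"
      by (simp add: bN)
    also have "cmod \<dots> \<le> (\<Sum>i\<in>K. cmod (poly f (\<mu> i)) * (\<Sum>i\<in>K. cmod (b (Some i))))"
      using assms(1) by (intro sum_norm_le) (auto simp: norm_mult intro!: mult_left_mono member_le_sum)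
    finally show ?thesis unfolding sum_distrib_right[symmetric] by (simp add: mult.commute)
  qed
  then show ?thesis by (intro exI[of _ "\<Sum>i\<in>K. cmod (b (Some i))"]) (auto intro: sum_nonneg)
qed

section \<open>Stability of the annihilation conditions\<close>

text \<open>The determinant of the system is \<open>\<bar>P A\<bar>\<^sup>2 + \<bar>Q B\<bar>\<^sup>2\<close>, which dominates \<open>\<bar>A\<bar>\<^sup>2 + \<bar>B\<bar>\<^sup>2\<close>.\<close>

lemma soliton_system_estimate:
  fixes F G P Q A B e :: complex
  assumes "P \<noteq> 0" "Q \<noteq> 0" "A \<noteq> 0"
    and eq1: "F * P * A = G * Q * B" and eq2: "F * cnj Q * cnj B + G * cnj P * cnj A = e"
    and e: "cmod e \<le> d * (cmod A + cmod B)"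
  defines "c \<equiv> 2 * (cmod P + cmod Q) / (min (cmod P) (cmod Q))\<^sup>2"
  shows "cmod F \<le> c * d" "cmod G \<le> c * d"
proof -
  define k where "k = min (cmod P) (cmod Q)"
  have k: "k > 0" "k \<le> cmod P" "k \<le> cmod Q" using assms by (auto simp: k_def)
  define x where "x = cmod A"
  define y where "y = cmod B"
  have xy: "x > 0" "y \<ge> 0" using assms by (auto simp: x_def y_def)
  have d0: "d \<ge> 0"
  proof -
    have "0 \<le> d * (x + y)" using e norm_ge_zero[of e] unfolding x_def y_def by linarith
    then show ?thesis using xy by (simp add: zero_le_mult_iff)
  qed
  define D where "D = (cmod Q * y)\<^sup>2 + (cmod P * x)\<^sup>2"
  have D: "complex_of_real D = Q * cnj Q * (B * cnj B) + P * cnj P * (A * cnj A)"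
    unfolding D_def x_def y_def by (simp add: power_mult_distrib complex_norm_square[symmetric] del: complex_mult_cnj)
  \<comment> \<open>Cramer's rule for the two equations, without dividing by the
    determinant.\<close>
  have FD: "F * complex_of_real D = e * (Q * B)" and GD: "G * complex_of_real D = e * (P * A)"
    unfolding D eq2[symmetric] using eq1 by algebra+
  have Dge: "k\<^sup>2 * (x\<^sup>2 + y\<^sup>2) \<le> D"
    unfolding D_def power_mult_distrib distrib_left using k
    by (smt (verit) mult_right_mono power_mono zero_le_power2)
  have pos: "k\<^sup>2 * (x\<^sup>2 + y\<^sup>2) > 0" using k xy by (intro mult_pos_pos add_pos_nonneg) auto
  \<comment> \<open>The right-hand side is a product of two factors of order |A| + |B|, and the
    determinant is at least of order |A|^2 + |B|^2, so the size of (A, B) cancels. The 2 in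
    \<open>c\<close> comes from (x + y)^2 \<le> 2 (x^2 + y^2).\<close>
  have est: "cmod Z \<le> c * d" if Z: "Z * complex_of_real D = e * (R * E)" and R: "cmod R \<le> cmod P + cmod Q"
    and E: "cmod E \<le> x + y" for Z R E
  proof -
    have "cmod Z * D = cmod e * (cmod R * cmod E)"
      using arg_cong[OF Z, of cmod] pos Dge by (simp add: norm_mult)
    also have "\<dots> \<le> (d * (x + y)) * ((cmod P + cmod Q) * (x + y))"
      using e R E xy d0 unfolding x_def[symmetric] y_def[symmetric]
      by (intro mult_mono) auto
    also have "\<dots> = d * (cmod P + cmod Q) * (x + y)\<^sup>2" by (simp add: power2_eq_square)
    also have "(x + y)\<^sup>2 \<le> 2 * (x\<^sup>2 + y\<^sup>2)"
      using sum_squares_bound[of x y] by (simp add: power2_sum)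
    finally have "cmod Z * D \<le> d * (cmod P + cmod Q) * (2 * (x\<^sup>2 + y\<^sup>2))"
      using d0 by (simp add: mult_left_mono)
    moreover have "cmod Z * (k\<^sup>2 * (x\<^sup>2 + y\<^sup>2)) \<le> cmod Z * D" using Dge by (simp add: mult_left_mono)
    ultimately have "(cmod Z * k\<^sup>2) * (x\<^sup>2 + y\<^sup>2) \<le> (2 * d * (cmod P + cmod Q)) * (x\<^sup>2 + y\<^sup>2)"
      by (simp add: algebra_simps)
    moreover have "x\<^sup>2 + y\<^sup>2 > 0" using xy by (intro add_pos_nonneg) auto
    ultimately have "cmod Z * k\<^sup>2 \<le> 2 * d * (cmod P + cmod Q)"
      by (simp add: mult_le_cancel_right)
    then show ?thesis using k unfolding c_def k_def[symmetric] by (simp add: field_simps)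
  qed
  show "cmod F \<le> c * d" by (rule est[OF FD]) (use xy in \<open>auto simp: y_def\<close>)
  show "cmod G \<le> c * d" by (rule est[OF GD]) (use xy in \<open>auto simp: x_def\<close>)
qed

text \<open>The row \<open>(f, g)\<close> of a matrix polynomial kills the first column \<open>(A, -B)\<close> of \<open>\<psi>\<close>
  at \<open>\<kappa>\<close> and its second column \<open>(cnj B, cnj A)\<close> at \<open>cnj \<kappa>\<close>.\<close>

definition annihilates_soliton ::
  "nat \<Rightarrow> complex \<Rightarrow> complex poly \<Rightarrow> complex poly \<Rightarrow> complex \<Rightarrow> complex \<Rightarrow> bool" where
  "annihilates_soliton N \<kappa> f g A B \<longleftrightarrow>
     degree f \<le> N \<and> degree g \<le> N \<and> A \<noteq> 0 \<and>
     poly f \<kappa> * A = poly g \<kappa> * B \<and> poly f (cnj \<kappa>) * cnj B + poly g (cnj \<kappa>) * cnj A = 0"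

text \<open>Up to multiples of the node values, \<open>f\<close> is F p and \<open>g\<close> is G q,
  where p and q are the products over the \<mu>_i and the \<nu>_i. As \<nu>_i = cnj \<mu>_i, the
  values of p and q at cnj \<kappa> are the conjugates of those of q and p at \<kappa>. So the
  conditions at \<kappa> and cnj \<kappa> are the system of \<open>soliton_system_estimate\<close>
  for F and G, which makes F and G small too.\<close>

lemma row_pair_estimate:
  fixes \<mu> \<nu> :: "'b \<Rightarrow> complex"
  assumes K: "finite K" "inj_on \<mu> K" "inj_on \<nu> K"
    and \<kappa>: "\<kappa> \<notin> \<mu> ` K" "\<kappa> \<notin> \<nu> ` K"
    and conj: "\<And>i. i \<in> K \<Longrightarrow> \<nu> i = cnj (\<mu> i)"
  shows "\<exists>C\<ge>0. \<forall>f g A B. annihilates_soliton (card K) \<kappa> f g A B \<longrightarrow>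
     cmod (poly f z) \<le> C * (\<Sum>i\<in>K. cmod (poly f (\<mu> i)) + cmod (poly g (\<nu> i))) \<and>
     cmod (poly g z) \<le> C * (\<Sum>i\<in>K. cmod (poly f (\<mu> i)) + cmod (poly g (\<nu> i)))"
proof -
  define p where "p = (\<lambda>z. \<Prod>i\<in>K. z - \<mu> i)"
  define q where "q = (\<lambda>z. \<Prod>i\<in>K. z - \<nu> i)"
  have pq: "p \<kappa> \<noteq> 0" "q \<kappa> \<noteq> 0" using K(1) \<kappa> by (auto simp: p_def q_def)
  have cpq: "p (cnj \<kappa>) = cnj (q \<kappa>)" "q (cnj \<kappa>) = cnj (p \<kappa>)"
    using conj by (simp_all add: p_def q_def cnj_prod)
  obtain C1 where C1: "C1 \<ge> 0" "\<And>f. degree f \<le> card K \<Longrightarrow> cmod (poly f (cnj \<kappa>) - poly f \<kappa> / p \<kappa> * p (cnj \<kappa>)) \<le> C1 * (\<Sum>i\<in>K. cmod (poly f (\<mu> i)))"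
    using poly_node_estimate[OF K(1,2) \<kappa>(1), of "cnj \<kappa>"] unfolding p_def by blast
  obtain C2 where C2: "C2 \<ge> 0" "\<And>f. degree f \<le> card K \<Longrightarrow> cmod (poly f (cnj \<kappa>) - poly f \<kappa> / q \<kappa> * q (cnj \<kappa>)) \<le> C2 * (\<Sum>i\<in>K. cmod (poly f (\<nu> i)))"
    using poly_node_estimate[OF K(1,3) \<kappa>(2), of "cnj \<kappa>"] unfolding q_def by blast
  obtain C3 where C3: "C3 \<ge> 0" "\<And>f. degree f \<le> card K \<Longrightarrow> cmod (poly f z - poly f \<kappa> / p \<kappa> * p z) \<le> C3 * (\<Sum>i\<in>K. cmod (poly f (\<mu> i)))"
    using poly_node_estimate[OF K(1,2) \<kappa>(1), of z] unfolding p_def by blast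
  obtain C4 where C4: "C4 \<ge> 0" "\<And>f. degree f \<le> card K \<Longrightarrow> cmod (poly f z - poly f \<kappa> / q \<kappa> * q z) \<le> C4 * (\<Sum>i\<in>K. cmod (poly f (\<nu> i)))"
    using poly_node_estimate[OF K(1,3) \<kappa>(2), of z] unfolding q_def by blast
  define c where "c = 2 * (cmod (p \<kappa>) + cmod (q \<kappa>)) / (min (cmod (p \<kappa>)) (cmod (q \<kappa>)))\<^sup>2"
  have c0: "c \<ge> 0" by (simp add: c_def)
  define C where "C = C3 + C4 + c * (C1 + C2) * (cmod (p z) + cmod (q z))"
  show ?thesis
  proof (intro exI[of _ C] conjI allI impI)
    show "C \<ge> 0" using C1(1) C2(1) C3(1) C4(1) c0 by (simp add: C_def)
    fix f g A B
    assume "annihilates_soliton (card K) \<kappa> f g A B"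
    then have f: "degree f \<le> card K" and g: "degree g \<le> card K" and A: "A \<noteq> 0"
      and e1: "poly f \<kappa> * A = poly g \<kappa> * B"
      and e2: "poly f (cnj \<kappa>) * cnj B + poly g (cnj \<kappa>) * cnj A = 0"
      unfolding annihilates_soliton_def by auto
    define s where "s = (\<Sum>i\<in>K. cmod (poly f (\<mu> i)))"
    define t where "t = (\<Sum>i\<in>K. cmod (poly g (\<nu> i)))"
    have st: "s \<ge> 0" "t \<ge> 0" by (auto simp: s_def t_def intro: sum_nonneg)
    define d where "d = s + t"
    have d: "d \<ge> 0" "s \<le> d" "t \<le> d" using st by (auto simp: d_def)
    have dsum: "(\<Sum>i\<in>K. cmod (poly f (\<mu> i)) + cmod (poly g (\<nu> i))) = d"
      by (simp add: d_def s_def t_def sum.distrib)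
    define F where "F = poly f \<kappa> / p \<kappa>"
    define G where "G = poly g \<kappa> / q \<kappa>"
    define x where "x = poly f (cnj \<kappa>) - F * p (cnj \<kappa>)"
    define y where "y = poly g (cnj \<kappa>) - G * q (cnj \<kappa>)"
    have x: "cmod x \<le> C1 * d"
      using C1(2)[OF f] mult_left_mono[OF d(2) C1(1)] unfolding x_def F_def s_def by linarith
    have y: "cmod y \<le> C2 * d"
      using C2(2)[OF g] mult_left_mono[OF d(3) C2(1)] unfolding y_def G_def t_def by linarith
    have "F * p \<kappa> * A = G * q \<kappa> * B" using e1 pq by (simp add: F_def G_def)
    moreover have "F * cnj (q \<kappa>) * cnj B + G * cnj (p \<kappa>) * cnj A = - (x * cnj B + y * cnj A)"
      using e2 unfolding x_def y_def cpq by algebra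
    moreover have "cmod (- (x * cnj B + y * cnj A)) \<le> ((C1 + C2) * d) * (cmod A + cmod B)"
    proof -
      have "cmod (- (x * cnj B + y * cnj A)) \<le> cmod x * cmod B + cmod y * cmod A"
        unfolding norm_minus_cancel by (intro order.trans[OF norm_triangle_ineq]) (simp add: norm_mult)
      also have "\<dots> \<le> (C1 + C2) * d * cmod B + (C1 + C2) * d * cmod A"
        using x y d(1) C1(1) C2(1) by (intro add_mono mult_right_mono) (auto simp: algebra_simps intro: add_increasing add_increasing2)
      finally show ?thesis by (simp add: algebra_simps)
    qed
    ultimately have FG: "cmod F \<le> c * ((C1 + C2) * d)" "cmod G \<le> c * ((C1 + C2) * d)"
      using soliton_system_estimate[OF pq A] unfolding c_def by blast+
    have nonneg: "c * ((C1 + C2) * d) \<ge> 0" using c0 C1(1) C2(1) d(1) by simp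
    have "cmod (poly f z) \<le> cmod (poly f z - F * p z) + cmod (F * p z)"
      by (metis diff_add_cancel norm_triangle_ineq)
    also have "cmod (poly f z - F * p z) \<le> C3 * d"
      using C3(2)[OF f] mult_left_mono[OF d(2) C3(1)] unfolding F_def s_def by linarith
    also have "cmod (F * p z) \<le> c * ((C1 + C2) * d) * (cmod (p z) + cmod (q z))"
      unfolding norm_mult using FG nonneg by (intro mult_mono) auto
    also have "C3 * d + c * ((C1 + C2) * d) * (cmod (p z) + cmod (q z)) \<le> C * d"
      using C4(1) d(1) by (simp add: C_def algebra_simps)
    finally show "cmod (poly f z) \<le> C * (\<Sum>i\<in>K. cmod (poly f (\<mu> i)) + cmod (poly g (\<nu> i)))"
      unfolding dsum by simp
    have "cmod (poly g z) \<le> cmod (poly g z - G * q z) + cmod (G * q z)"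
      by (metis diff_add_cancel norm_triangle_ineq)
    also have "cmod (poly g z - G * q z) \<le> C4 * d"
      using C4(2)[OF g] mult_left_mono[OF d(3) C4(1)] unfolding G_def t_def by linarith
    also have "cmod (G * q z) \<le> c * ((C1 + C2) * d) * (cmod (p z) + cmod (q z))"
      unfolding norm_mult using FG nonneg by (intro mult_mono) auto
    also have "C4 * d + c * ((C1 + C2) * d) * (cmod (p z) + cmod (q z)) \<le> C * d"
      using C3(1) d(1) by (simp add: C_def algebra_simps)
    finally show "cmod (poly g z) \<le> C * (\<Sum>i\<in>K. cmod (poly f (\<mu> i)) + cmod (poly g (\<nu> i)))"
      unfolding dsum by simp
  qed
qed

text \<open>The bootstrap. The hypotheses bound the node sum \<open>d\<close> by the ratios
  \<open>t i\<close> times values of the other polynomial, and \<open>row_pair_estimate\<close>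
  bounds these values by \<open>C * d\<close>. If the ratios are small, the term with
  \<open>d\<close> is absorbed and d \<le> 4 R \<open>sum t K\<close> remains.\<close>

lemma row_pair_asymptotics:
  fixes \<mu> \<nu> :: "'b \<Rightarrow> complex"
  assumes K: "finite K" "inj_on \<mu> K" "inj_on \<nu> K"
    and \<kappa>: "\<kappa> \<notin> \<mu> ` K" "\<kappa> \<notin> \<nu> ` K"
    and conj: "\<And>i. i \<in> K \<Longrightarrow> \<nu> i = cnj (\<mu> i)"
    and R: "R \<ge> 0"
  shows "\<exists>M c. c > 0 \<and> (\<forall>f g A B t. annihilates_soliton (card K) \<kappa> f g A B \<and>
     (\<forall>i\<in>K. t i \<ge> 0 \<and> cmod (poly f (\<mu> i)) \<le> t i * (cmod (poly g (\<mu> i)) + R) \<and>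
        cmod (poly g (\<nu> i)) \<le> t i * (cmod (poly f (\<nu> i)) + R)) \<and> sum t K \<le> c \<longrightarrow>
     cmod (poly f z) \<le> M * sum t K \<and> cmod (poly g z) \<le> M * sum t K)"
proof -
  let ?P = "\<lambda>z C. C\<ge>0 \<and> (\<forall>f g A B. annihilates_soliton (card K) \<kappa> f g A B \<longrightarrow>
     cmod (poly f z) \<le> C * (\<Sum>i\<in>K. cmod (poly f (\<mu> i)) + cmod (poly g (\<nu> i))) \<and>
     cmod (poly g z) \<le> C * (\<Sum>i\<in>K. cmod (poly f (\<mu> i)) + cmod (poly g (\<nu> i))))"
  have "\<forall>z. \<exists>C. ?P z C" using row_pair_estimate[OF K \<kappa> conj] by blast
  from choice[OF this] obtain Cz where "\<forall>z. ?P z (Cz z)" ..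
  then have Cz: "?P z (Cz z)" for z by (rule spec)
  \<comment> \<open>The estimate is used at every node as well as at the target \<open>z\<close>;
    this constant serves all nodes.\<close>
  define C where "C = (\<Sum>i\<in>K. Cz (\<mu> i) + Cz (\<nu> i))"
  have Cz0: "Cz z \<ge> 0" for z using Cz by blast
  have C0: "C \<ge> 0" using Cz0 by (auto simp: C_def intro!: sum_nonneg add_nonneg_nonneg)
  have Cle: "Cz (\<mu> i) \<le> C" "Cz (\<nu> i) \<le> C" if "i \<in> K" for i
  proof -
    have "Cz (\<mu> i) + Cz (\<nu> i) \<le> C"
      unfolding C_def using that K(1) Cz0 by (intro member_le_sum[where f = "\<lambda>i. Cz (\<mu> i) + Cz (\<nu> i)"]) auto
    then show "Cz (\<mu> i) \<le> C" "Cz (\<nu> i) \<le> C" using Cz0[of "\<mu> i"] Cz0[of "\<nu> i"] by linarith+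
  qed
  \<comment> \<open>Chosen so that 2 c C \<le> 1/2, which absorbs half of \<open>d\<close>.\<close>
  define c where "c = 1 / (4 * (C + 1))"
  show ?thesis
  proof (rule exI[of _ "Cz z * (4 * R)"], rule exI[of _ c], intro conjI allI impI)
    show "c > 0" using C0 by (simp add: c_def)
  next
    fix f g A B t
    assume h: "annihilates_soliton (card K) \<kappa> f g A B \<and>
     (\<forall>i\<in>K. t i \<ge> 0 \<and> cmod (poly f (\<mu> i)) \<le> t i * (cmod (poly g (\<mu> i)) + R) \<and>
        cmod (poly g (\<nu> i)) \<le> t i * (cmod (poly f (\<nu> i)) + R)) \<and> sum t K \<le> c"
    define d where "d = (\<Sum>i\<in>K. cmod (poly f (\<mu> i)) + cmod (poly g (\<nu> i)))"
    have d0: "d \<ge> 0" by (auto simp: d_def intro!: sum_nonneg)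
    have est: "cmod (poly f z) \<le> Cz z * d \<and> cmod (poly g z) \<le> Cz z * d" for z
      using Cz[of z] h unfolding d_def by blast
    have t0: "sum t K \<ge> 0" using h by (auto intro: sum_nonneg)
    have "d \<le> (\<Sum>i\<in>K. t i * (2 * (C * d + R)))"
      unfolding d_def
    proof (rule sum_mono, fold d_def)
      fix i assume i: "i \<in> K"
      have "cmod (poly g (\<mu> i)) \<le> C * d" "cmod (poly f (\<nu> i)) \<le> C * d"
        using est[of "\<mu> i"] est[of "\<nu> i"] mult_right_mono[OF Cle(1)[OF i] d0] mult_right_mono[OF Cle(2)[OF i] d0] by linarith+
      then have "t i * (cmod (poly g (\<mu> i)) + R) \<le> t i * (C * d + R)" "t i * (cmod (poly f (\<nu> i)) + R) \<le> t i * (C * d + R)"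
        using h i by (auto intro!: mult_left_mono)
      then show "cmod (poly f (\<mu> i)) + cmod (poly g (\<nu> i)) \<le> t i * (2 * (C * d + R))"
        using h i by (smt (verit) distrib_left mult_2)
    qed
    also have "\<dots> = 2 * sum t K * C * d + 2 * R * sum t K"
      unfolding sum_distrib_right[symmetric] by (simp add: algebra_simps)
    finally have *: "d \<le> 2 * sum t K * C * d + 2 * R * sum t K" .
    have "2 * sum t K * C \<le> 2 * c * (C + 1)" using h t0 C0 by (intro mult_mono) auto
    also have "\<dots> = 1 / 2" using C0 by (simp add: c_def field_simps)
    finally have "2 * sum t K * C * d \<le> 1 / 2 * d" using d0 by (rule mult_right_mono)
    with * have "d \<le> 4 * R * sum t K" by linarith
    then have "Cz z * d \<le> Cz z * (4 * R) * sum t K"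
      using mult_left_mono[OF _ Cz0[of z]] by (simp add: mult.assoc)
    then show "cmod (poly f z) \<le> Cz z * (4 * R) * sum t K" "cmod (poly g z) \<le> Cz z * (4 * R) * sum t K"
      using est[of z] by linarith+
  qed
qed

section \<open>Asymptotics of the quasi-Wronskian\<close>

lemma degree_le_of_coeff_eq_0:
  assumes "degree p \<le> Suc N" "coeff p (Suc N) = 0"
  shows "degree p \<le> N"
proof (rule degree_le, intro allI impI)
  fix i assume "N < i"
  then consider "i = Suc N" | "i > Suc N" by linarith
  then show "coeff p i = 0" using assms by cases (auto intro: coeff_eq_0)
qed

lemma monic_linear_prod:
  fixes \<mu> :: "'b \<Rightarrow> 'a::idom"
  assumes "finite K"
  shows "degree (\<Prod>i\<in>K. [:- \<mu> i, 1:]) = card K" "coeff (\<Prod>i\<in>K. [:- \<mu> i, 1:]) (card K) = 1"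
proof -
  show *: "degree (\<Prod>i\<in>K. [:- \<mu> i, 1:]) = card K"
    by (subst degree_prod_eq_sum_degree) auto
  have "lead_coeff (\<Prod>i\<in>K. [:- \<mu> i, 1:]) = 1"
    by (simp add: lead_coeff_prod)
  then show "coeff (\<Prod>i\<in>K. [:- \<mu> i, 1:]) (card K) = 1"
    unfolding * .
qed

text \<open>Both polynomials have the coefficient \<open>e\<close> at z^n, so their difference has
  degree at most n - 1 and is determined by the \<open>card K\<close> nodes together with one
  further node.\<close>

lemma degree_monic_diff:
  fixes \<mu> :: "'b \<Rightarrow> 'a::idom"
  assumes "finite K" and "n = Suc (card K)"
  shows "degree (monom e n + (\<Sum>r\<in>{1..n}. monom (q r) (r - 1)) - [:k, e:] * (\<Prod>i\<in>K. [:- \<mu> i, 1:])) \<le> card K"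
proof (rule degree_le_of_coeff_eq_0)
  let ?p = "\<Prod>i\<in>K. [:- \<mu> i, 1:]"
  have 1: "degree (monom e n) \<le> n" by (rule degree_monom_le)
  have 2: "degree (\<Sum>r\<in>{1..n}. monom (q r) (r - 1)) \<le> n"
    by (intro degree_sum_le) (auto intro: order.trans[OF degree_monom_le])
  have 3: "degree ([:k, e:] * ?p) \<le> n"
    by (rule order.trans[OF degree_mult_le]) (auto simp: monic_linear_prod assms)
  show "degree (monom e n + (\<Sum>r\<in>{1..n}. monom (q r) (r - 1)) - [:k, e:] * ?p) \<le> Suc (card K)"
    using 1 2 3 unfolding assms(2)[symmetric] by (intro degree_diff_le degree_add_le)
  have "coeff (\<Sum>r\<in>{1..n}. monom (q r) (r - 1)) n = 0"
    by (auto simp: coeff_sum intro!: sum.neutral)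
  moreover have "coeff ?p n = 0"
    by (rule coeff_eq_0) (simp add: monic_linear_prod assms)
  ultimately show "coeff (monom e n + (\<Sum>r\<in>{1..n}. monom (q r) (r - 1)) - [:k, e:] * ?p) (Suc (card K)) = 0"
    unfolding assms(2)[symmetric] using monic_linear_prod(2)[OF assms(1), of \<mu>]
    by (simp add: assms(2))
qed

lemma nonresonant_lam_sgn:
  assumes "nonresonant n l" "i \<in> {1..n}" "j \<in> {1..n}" "i \<noteq> j"
  shows "lam_sgn (l i) e \<noteq> lam_sgn (l j) e'" "l i \<noteq> lam_sgn (l j) e'"
  using assms unfolding nonresonant_def lam_sgn_def by (auto, (metis complex_cnj_cnj)+)

text \<open>One row of the matrix polynomial, stated for numbers so that \<open>c\<close> and
  \<open>M\<close> do not depend on the point. (e1, e2) is its leading coefficient, q1 and q2 give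
  the lower ones, and (k1, k2) is a row of k. The two families of equations are the annihilation
  conditions of this row; the next two equations are those of the limit row at \<lambda>_I and its
  conjugate. The conclusion compares both rows at z = 0.\<close>

lemma soliton_row_limit:
  fixes l :: "nat \<Rightarrow> complex" and \<epsilon> :: "nat \<Rightarrow> real"
  assumes I: "I \<in> {1..n}" and nr: "nonresonant n l"
    and \<epsilon>: "\<forall>i\<in>{1..n} - {I}. \<epsilon> i = 1 \<or> \<epsilon> i = -1" and R: "R \<ge> 0"
  defines "K \<equiv> {1..n} - {I}"
  defines "\<mu> \<equiv> \<lambda>i. lam_sgn (l i) (\<epsilon> i)" and "\<nu> \<equiv> \<lambda>i. lam_sgn (l i) (- \<epsilon> i)"
  defines "P \<equiv> (\<Prod>i\<in>K. l I - \<mu> i)" and "Q \<equiv> (\<Prod>i\<in>K. l I - \<nu> i)"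
  obtains c M where "c > 0" and "\<And>A B q1 q2 e1 e2 k1 k2 \<tau>.
    (\<forall>s\<in>{1..n}. A s \<noteq> 0 \<and> B s \<noteq> 0) \<Longrightarrow>
    cmod e1 \<le> 1 \<Longrightarrow> cmod e2 \<le> 1 \<Longrightarrow> cmod k1 \<le> R \<Longrightarrow> cmod k2 \<le> R \<Longrightarrow>
    (\<forall>s\<in>{1..n}. e1 * A s * l s ^ n - e2 * B s * l s ^ n
        + (\<Sum>r\<in>{1..n}. (q1 r * A s - q2 r * B s) * l s ^ (r - 1)) = 0) \<Longrightarrow>
    (\<forall>s\<in>{1..n}. e1 * cnj (B s) * cnj (l s) ^ n + e2 * cnj (A s) * cnj (l s) ^ n
        + (\<Sum>r\<in>{1..n}. (q1 r * cnj (B s) + q2 r * cnj (A s)) * cnj (l s) ^ (r - 1)) = 0) \<Longrightarrow>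
    (e1 * l I + k1) * (P * A I) = (e2 * l I + k2) * (Q * B I) \<Longrightarrow>
    (e1 * cnj (l I) + k1) * cnj (Q * B I) + (e2 * cnj (l I) + k2) * cnj (P * A I) = 0 \<Longrightarrow>
    \<tau> = (\<Sum>i\<in>K. if \<epsilon> i = 1 then cmod (B i / A i) else cmod (A i / B i)) \<Longrightarrow> \<tau> \<le> c \<Longrightarrow>
    cmod (q1 1 - k1 * (\<Prod>i\<in>K. - \<mu> i)) \<le> M * \<tau> \<and> cmod (q2 1 - k2 * (\<Prod>i\<in>K. - \<nu> i)) \<le> M * \<tau>"
proof -
  have K: "finite K" "n = Suc (card K)" using I by (auto simp: K_def)
  have n1: "n \<ge> 1" using I by auto
  have inj: "inj_on \<mu> K" "inj_on \<nu> K"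
    using nonresonant_lam_sgn(1)[OF nr] unfolding inj_on_def K_def \<mu>_def \<nu>_def by blast+
  have \<kappa>: "l I \<notin> \<mu> ` K" "l I \<notin> \<nu> ` K"
    using nonresonant_lam_sgn(2)[OF nr I] unfolding K_def \<mu>_def \<nu>_def by blast+
  have sgn: "\<epsilon> i = 1 \<and> \<mu> i = l i \<and> \<nu> i = cnj (l i) \<or> \<epsilon> i = -1 \<and> \<mu> i = cnj (l i) \<and> \<nu> i = l i"
    if "i \<in> K" for i
    using \<epsilon> that unfolding K_def \<mu>_def \<nu>_def lam_sgn_def by auto
  then have conj: "\<nu> i = cnj (\<mu> i)" if "i \<in> K" for i
    using that by force
  define p where "p = (\<Prod>i\<in>K. [:- \<mu> i, 1:])"
  define q where "q = (\<Prod>i\<in>K. [:- \<nu> i, 1:])"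
  have pP: "poly p z = (\<Prod>i\<in>K. z - \<mu> i)" and qQ: "poly q z = (\<Prod>i\<in>K. z - \<nu> i)" for z
    by (simp_all add: p_def q_def poly_prod)
  have p\<mu>: "poly p (\<mu> i) = 0" and q\<nu>: "poly q (\<nu> i) = 0" if "i \<in> K" for i
    using that K(1) by (auto simp: pP qQ)
  have cPQ: "poly p (cnj (l I)) = cnj Q" "poly q (cnj (l I)) = cnj P"
    using conj by (simp_all add: pP qQ P_def Q_def cnj_prod)
  \<comment> \<open>The limit row vanishes at \<mu>_i in its first and at \<nu>_i in its second
    entry. \<open>R'\<close> bounds its entries at the opposite nodes and becomes the
    \<open>R\<close> of \<open>row_pair_asymptotics\<close>.\<close>
  define R' where "R' = (\<Sum>i\<in>K. (cmod (\<mu> i) + cmod (\<nu> i) + R) * (cmod (poly p (\<nu> i)) + cmod (poly q (\<mu> i))))"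
  have R'0: "R' \<ge> 0" unfolding R'_def using R by (intro sum_nonneg mult_nonneg_nonneg add_nonneg_nonneg) auto
  have R'i: "(cmod (\<mu> i) + cmod (\<nu> i) + R) * (cmod (poly p (\<nu> i)) + cmod (poly q (\<mu> i))) \<le> R'" if "i \<in> K" for i
    unfolding R'_def using that K(1) R
    by (intro member_le_sum[where f = "\<lambda>i. (cmod (\<mu> i) + cmod (\<nu> i) + R) * (cmod (poly p (\<nu> i)) + cmod (poly q (\<mu> i)))"]) auto
  obtain M c where c: "c > 0" and M: "\<And>f g A B t. annihilates_soliton (card K) (l I) f g A B \<and>
     (\<forall>i\<in>K. t i \<ge> 0 \<and> cmod (poly f (\<mu> i)) \<le> t i * (cmod (poly g (\<mu> i)) + R') \<and>
        cmod (poly g (\<nu> i)) \<le> t i * (cmod (poly f (\<nu> i)) + R')) \<and> sum t K \<le> c \<Longrightarrow>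
     cmod (poly f 0) \<le> M * sum t K \<and> cmod (poly g 0) \<le> M * sum t K"
    using row_pair_asymptotics[OF K(1) inj \<kappa> conj R'0, of 0] by blast
  show thesis
  proof (rule that[of c M, OF c])
    fix A B q1 q2 e1 e2 k1 k2 \<tau>
    assume AB: "\<forall>s\<in>{1..n}. A s \<noteq> 0 \<and> B s \<noteq> 0"
      and ek: "cmod e1 \<le> 1" "cmod e2 \<le> 1" "cmod k1 \<le> R" "cmod k2 \<le> R"
      and eq1: "\<forall>s\<in>{1..n}. e1 * A s * l s ^ n - e2 * B s * l s ^ n
        + (\<Sum>r\<in>{1..n}. (q1 r * A s - q2 r * B s) * l s ^ (r - 1)) = 0"
      and eq2: "\<forall>s\<in>{1..n}. e1 * cnj (B s) * cnj (l s) ^ n + e2 * cnj (A s) * cnj (l s) ^ n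
        + (\<Sum>r\<in>{1..n}. (q1 r * cnj (B s) + q2 r * cnj (A s)) * cnj (l s) ^ (r - 1)) = 0"
      and eq3: "(e1 * l I + k1) * (P * A I) = (e2 * l I + k2) * (Q * B I)"
      and eq4: "(e1 * cnj (l I) + k1) * cnj (Q * B I) + (e2 * cnj (l I) + k2) * cnj (P * A I) = 0"
      and \<tau>: "\<tau> = (\<Sum>i\<in>K. if \<epsilon> i = 1 then cmod (B i / A i) else cmod (A i / B i))" "\<tau> \<le> c"
    define f0 where "f0 = [:k1, e1:] * p"
    define g0 where "g0 = [:k2, e2:] * q"
    define F where "F = monom e1 n + (\<Sum>r\<in>{1..n}. monom (q1 r) (r - 1))"
    define G where "G = monom e2 n + (\<Sum>r\<in>{1..n}. monom (q2 r) (r - 1))"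
    have F: "poly F z = e1 * z ^ n + (\<Sum>r\<in>{1..n}. q1 r * z ^ (r - 1))"
      and G: "poly G z = e2 * z ^ n + (\<Sum>r\<in>{1..n}. q2 r * z ^ (r - 1))" for z
      by (simp_all add: F_def G_def poly_sum poly_monom)
    have FG1: "poly F (l s) * A s = poly G (l s) * B s" if "s \<in> {1..n}" for s
      using bspec[OF eq1 that] unfolding F G
      by (simp add: algebra_simps sum_distrib_left sum_distrib_right sum.distrib sum_subtractf)
    have FG2: "poly F (cnj (l s)) * cnj (B s) + poly G (cnj (l s)) * cnj (A s) = 0" if "s \<in> {1..n}" for s
      using bspec[OF eq2 that] unfolding F G
      by (simp add: algebra_simps sum_distrib_left sum_distrib_right sum.distrib)
    have fg1: "poly f0 (l I) * A I = poly g0 (l I) * B I"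
      using eq3 unfolding f0_def g0_def by (simp add: pP qQ P_def Q_def algebra_simps)
    have fg2: "poly f0 (cnj (l I)) * cnj (B I) + poly g0 (cnj (l I)) * cnj (A I) = 0"
      using eq4 unfolding f0_def g0_def by (simp add: cPQ algebra_simps)
    have ann: "annihilates_soliton (card K) (l I) (F - f0) (G - g0) (A I) (B I)"
      unfolding annihilates_soliton_def
    proof (intro conjI)
      show "degree (F - f0) \<le> card K" "degree (G - g0) \<le> card K"
        unfolding F_def G_def f0_def g0_def p_def q_def by (rule degree_monic_diff[OF K])+
      show "A I \<noteq> 0" using AB I by auto
      show "poly (F - f0) (l I) * A I = poly (G - g0) (l I) * B I"
        using FG1[OF I] fg1 by (simp add: algebra_simps)
      have "poly (F - f0) (cnj (l I)) * cnj (B I) + poly (G - g0) (cnj (l I)) * cnj (A I) =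
          (poly F (cnj (l I)) * cnj (B I) + poly G (cnj (l I)) * cnj (A I)) -
          (poly f0 (cnj (l I)) * cnj (B I) + poly g0 (cnj (l I)) * cnj (A I))"
        by (simp add: algebra_simps)
      then show "poly (F - f0) (cnj (l I)) * cnj (B I) + poly (G - g0) (cnj (l I)) * cnj (A I) = 0"
        unfolding FG2[OF I] fg2 by simp
    qed
    define t where "t = (\<lambda>i. if \<epsilon> i = 1 then cmod (B i / A i) else cmod (A i / B i))"
    have nodes: "\<forall>i\<in>K. t i \<ge> 0 \<and> cmod (poly (F - f0) (\<mu> i)) \<le> t i * (cmod (poly (G - g0) (\<mu> i)) + R') \<and>
        cmod (poly (G - g0) (\<nu> i)) \<le> t i * (cmod (poly (F - f0) (\<nu> i)) + R')"
    proof
      fix i assume i: "i \<in> K"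
      then have i': "i \<in> {1..n}" by (auto simp: K_def)
      have AB0: "A i \<noteq> 0" "B i \<noteq> 0" using AB i' by auto
      have t0: "t i \<ge> 0" by (simp add: t_def)
      have f0i: "poly f0 (\<mu> i) = 0" "poly g0 (\<nu> i) = 0"
        by (simp_all add: f0_def g0_def p\<mu>[OF i] q\<nu>[OF i])
      have small: "cmod ((k + z * e) * w) \<le> R'"
        if "cmod k \<le> R" "cmod e \<le> 1" "cmod z \<le> cmod (\<mu> i) + cmod (\<nu> i)"
          "cmod w \<le> cmod (poly p (\<nu> i)) + cmod (poly q (\<mu> i))" for k e z w
      proof -
        have "cmod (k + z * e) \<le> cmod k + cmod z * cmod e"
          by (metis norm_mult norm_triangle_ineq)
        also have "\<dots> \<le> R + (cmod (\<mu> i) + cmod (\<nu> i)) * 1"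
          using that by (intro add_mono mult_mono) auto
        finally have "cmod ((k + z * e) * w) \<le> (cmod (\<mu> i) + cmod (\<nu> i) + R) * (cmod (poly p (\<nu> i)) + cmod (poly q (\<mu> i)))"
          unfolding norm_mult using that(4) R by (intro mult_mono) auto
        then show ?thesis using R'i[OF i] by linarith
      qed
      have g0R: "cmod (poly g0 (\<mu> i)) \<le> R'" and f0R: "cmod (poly f0 (\<nu> i)) \<le> R'"
        unfolding f0_def g0_def poly_mult poly_pCons poly_0 mult_zero_right add_0_right
        using ek by (auto intro!: small)
      have Gb: "cmod (poly G (\<mu> i)) \<le> cmod (poly (G - g0) (\<mu> i)) + R'"
        using g0R norm_triangle_ineq[of "poly (G - g0) (\<mu> i)" "poly g0 (\<mu> i)"] by simp
      have Fb: "cmod (poly F (\<nu> i)) \<le> cmod (poly (F - f0) (\<nu> i)) + R'"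
        using f0R norm_triangle_ineq[of "poly (F - f0) (\<nu> i)" "poly f0 (\<nu> i)"] by simp
      \<comment> \<open>For sign 1 the conditions at \<lambda>_i and its conjugate are solved for
        the entry multiplied by A_i or its conjugate, which is F at the first and G at the second
        node. For sign -1 they are solved for the entry multiplied by B_i or its conjugate.\<close>
      have "cmod (poly F (\<mu> i)) = t i * cmod (poly G (\<mu> i)) \<and> cmod (poly G (\<nu> i)) = t i * cmod (poly F (\<nu> i))"
        using sgn[OF i]
      proof (elim disjE conjE)
        assume e: "\<epsilon> i = 1" "\<mu> i = l i" "\<nu> i = cnj (l i)"
        have "poly F (\<mu> i) = (B i / A i) * poly G (\<mu> i)"
          using FG1[OF i'] AB0 unfolding e by (simp add: field_simps)
        moreover have "poly G (\<nu> i) = - (cnj (B i / A i) * poly F (\<nu> i))"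
          using FG2[OF i'] AB0 unfolding e by (simp add: field_simps eq_neg_iff_add_eq_0)
        ultimately show ?thesis
          by (simp only: norm_mult norm_minus_cancel complex_mod_cnj t_def e if_True simp_thms)
      next
        assume e: "\<epsilon> i = -1" "\<mu> i = cnj (l i)" "\<nu> i = l i"
        have "poly G (\<nu> i) = (A i / B i) * poly F (\<nu> i)"
          using FG1[OF i'] AB0 unfolding e by (simp add: field_simps)
        moreover have "poly F (\<mu> i) = - (cnj (A i / B i) * poly G (\<mu> i))"
          using FG2[OF i'] AB0 unfolding e by (simp add: field_simps eq_neg_iff_add_eq_0)
        moreover have "t i = cmod (A i / B i)" by (simp add: t_def e)
        ultimately show ?thesis
          by (simp only: norm_mult norm_minus_cancel complex_mod_cnj simp_thms)
      qed
      then show "t i \<ge> 0 \<and> cmod (poly (F - f0) (\<mu> i)) \<le> t i * (cmod (poly (G - g0) (\<mu> i)) + R') \<and>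
        cmod (poly (G - g0) (\<nu> i)) \<le> t i * (cmod (poly (F - f0) (\<nu> i)) + R')"
        using t0 mult_left_mono[OF Gb t0] mult_left_mono[OF Fb t0] by (simp add: f0i)
    qed
    have \<tau>': "\<tau> = sum t K" using \<tau>(1) by (simp add: t_def)
    \<comment> \<open>Only \<open>r = 1\<close> contributes, by 0^0 = 1.\<close>
    have sum1: "(\<Sum>r\<in>{1..n}. h r * 0 ^ (r - 1)) = h 1" for h :: "nat \<Rightarrow> complex"
    proof -
      have "(\<Sum>r\<in>{1..n}. h r * 0 ^ (r - 1)) = (\<Sum>r\<in>{1..n}. if r = 1 then h 1 else 0)"
        by (intro sum.cong) auto
      then show ?thesis using n1 by simp
    qed
    have "poly (F - f0) 0 = q1 1 - k1 * (\<Prod>i\<in>K. - \<mu> i)" "poly (G - g0) 0 = q2 1 - k2 * (\<Prod>i\<in>K. - \<nu> i)"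
      using n1 sum1 by (simp_all add: F G f0_def g0_def pP qQ)
    then show "cmod (q1 1 - k1 * (\<Prod>i\<in>K. - \<mu> i)) \<le> M * \<tau> \<and> cmod (q2 1 - k2 * (\<Prod>i\<in>K. - \<nu> i)) \<le> M * \<tau>"
      using M[of "F - f0" "G - g0" "A I" "B I" t] ann nodes \<tau>(2) unfolding \<tau>' by simp_all
  qed
qed

section \<open>From the block inverse to an annihilating matrix polynomial\<close>

lemma sum_matrix_mult: "(\<Sum>i\<in>S. f i) ** B = (\<Sum>i\<in>S. f i ** B)"
  by (induction S rule: infinite_finite_induct) (simp_all add: matrix_add_rdistrib)

lemma matrix_sum_ldistrib: "B ** (\<Sum>i\<in>S. f i) = (\<Sum>i\<in>S. B ** f i)"
  by (induction S rule: infinite_finite_induct) (simp_all add: matrix_add_ldistrib)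

lemma uminus_matrix_mult: "(- A) ** B = - (A ** (B :: 'a::ring_1^'n^'m))"
  by (simp add: matrix_matrix_mult_def vec_eq_iff sum_negf)

text \<open>\<open>Q\<close> is minus the last block row times the inverse of W. Multiplying by W on
  the right returns minus the last block row, which is the annihilation condition, and the last
  column (1, 0, ..., 0) of the quasideterminant selects \<open>Q 1\<close>.\<close>

lemma quasi_wronskian_coeffs:
  assumes n: "n \<ge> 1" and inv: "block_invertible {1..n} {1..n} (wronski_block \<psi> \<Lambda>)"
  obtains Q where "quasi_wronskian n \<psi> \<Lambda> = Q 1"
    and "\<And>s. s \<in> {1..n} \<Longrightarrow>
      \<psi> s ** mat_pow (\<Lambda> s) n + (\<Sum>r\<in>{1..n}. Q r ** (\<psi> s ** mat_pow (\<Lambda> s) (r - 1))) = 0"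
proof -
  define A where "A = (\<lambda>r s. if s \<le> n then wronski_block \<psi> \<Lambda> r s else if r = 1 then mat 1 else 0)"
  define V where "V = block_inv {1..n} {1..n} A"
  have A: "A r s = wronski_block \<psi> \<Lambda> r s" if "s \<in> {1..n}" for r s
    using that by (simp add: A_def)
  have An: "A r (n + 1) = (if r = 1 then mat 1 else 0)" for r by (simp add: A_def)
  \<comment> \<open>\<open>A\<close> has the additional column n + 1, so it is not the function
    \<open>wronski_block\<close>. Being an inverse involves only the columns up to n, where the two
    agree.\<close>
  have iff: "is_block_inverse {1..n} {1..n} A W \<longleftrightarrow> is_block_inverse {1..n} {1..n} (wronski_block \<psi> \<Lambda>) W" for W
  proof -
    have "(\<Sum>s\<in>{1..n}. A r s ** W s r') = (\<Sum>s\<in>{1..n}. wronski_block \<psi> \<Lambda> r s ** W s r')" for r r'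
      by (intro sum.cong refl) (simp only: A)
    then show ?thesis unfolding is_block_inverse_def by (simp only: A cong: ball_cong)
  qed
  have "is_block_inverse {1..n} {1..n} A V"
    using inv unfolding block_invertible_def V_def block_inv_def iff[symmetric] by (rule someI_ex)
  then have V: "(\<Sum>r\<in>{1..n}. V s r ** A r s') = (if s = s' then mat 1 else 0)"
    if "s \<in> {1..n}" "s' \<in> {1..n}" for s s'
    using that unfolding is_block_inverse_def by blast
  define Q where "Q = (\<lambda>r. - (\<Sum>s\<in>{1..n}. A (n + 1) s ** V s r))"
  have Q: "(\<Sum>r\<in>{1..n}. Q r ** A r s') = - A (n + 1) s'" if s': "s' \<in> {1..n}" for s'
  proof -
    have "(\<Sum>r\<in>{1..n}. Q r ** A r s') = - (\<Sum>r\<in>{1..n}. \<Sum>s\<in>{1..n}. A (n + 1) s ** (V s r ** A r s'))"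
      by (simp add: Q_def uminus_matrix_mult sum_matrix_mult sum_negf matrix_mul_assoc)
    also have "\<dots> = - (\<Sum>s\<in>{1..n}. A (n + 1) s ** (\<Sum>r\<in>{1..n}. V s r ** A r s'))"
      by (subst sum.swap) (simp add: matrix_sum_ldistrib)
    also have "\<dots> = - (\<Sum>s\<in>{1..n}. if s = s' then A (n + 1) s' else 0)"
    proof (intro arg_cong[where f = uminus] sum.cong refl)
      fix s assume "s \<in> {1..n}"
      from V[OF this s'] show "A (n + 1) s ** (\<Sum>r\<in>{1..n}. V s r ** A r s') = (if s = s' then A (n + 1) s' else 0)"
        by (simp del: One_nat_def)
    qed
    finally show ?thesis using s' by simp
  qed
  show thesis
  proof (rule that[of Q])
    have R: "{1..n + 1} - {n + 1} = {1..n}" by auto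
    have "quasi_wronskian n \<psi> \<Lambda> = A (n + 1) (n + 1) - (\<Sum>s\<in>{1..n}. \<Sum>r\<in>{1..n}. A (n + 1) s ** V s r ** A r (n + 1))"
      unfolding quasi_wronskian_def quasidet_def A_def[symmetric] R Let_def V_def ..
    also have "\<dots> = - (\<Sum>s\<in>{1..n}. \<Sum>r\<in>{1..n}. if r = 1 then A (n + 1) s ** V s 1 else 0)"
    proof -
      have "(\<Sum>s\<in>{1..n}. \<Sum>r\<in>{1..n}. A (n + 1) s ** V s r ** A r (n + 1)) =
        (\<Sum>s\<in>{1..n}. \<Sum>r\<in>{1..n}. if r = 1 then A (n + 1) s ** V s 1 else 0)"
        unfolding An by (intro sum.cong refl) simp
      moreover have "A (n + 1) (n + 1) = 0" using n by (simp add: A_def)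
      ultimately show ?thesis by simp
    qed
    also have "\<dots> = Q 1" using n by (simp add: Q_def)
    finally show "quasi_wronskian n \<psi> \<Lambda> = Q 1" .
    show "\<psi> s ** mat_pow (\<Lambda> s) n + (\<Sum>r\<in>{1..n}. Q r ** (\<psi> s ** mat_pow (\<Lambda> s) (r - 1))) = 0"
      if s: "s \<in> {1..n}" for s
      using Q[OF s] by (simp add: A[OF s] wronski_block_def)
  qed
qed

section \<open>Uniform bounds, phase shift and passage to the limit\<close>

lemma mat_pow_Lam: "mat_pow (Lam l) k = mat2 (l ^ k) 0 0 (cnj l ^ k)"
  by (induction k) (simp_all add: mat_pow_def mat2_one Lam_def mat2_mult)

lemma Psi_eq:
  "Psi a b L = mat2 (a * exp L) (cnj (b * exp (- L))) (- (b * exp (- L))) (cnj (a * exp L))"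
  by (simp add: Psi_def exp_cnj)

lemma soliton_functions_bounded:
  assumes "a \<noteq> 0"
  shows "cmod (soliton_T a b L) \<le> 1" "cmod (soliton_u a b L) \<le> 1" "cmod (soliton_v a b L) \<le> 1"
proof -
  define x where "x = cmod (a * exp L)"
  define y where "y = cmod (b * exp (- L))"
  have w: "cmod (soliton_norm a b L) = x\<^sup>2 + y\<^sup>2"
    unfolding soliton_norm_eq x_def y_def norm_of_real by simp
  have "x > 0" using assms by (simp add: x_def)
  then have w0: "x\<^sup>2 + y\<^sup>2 > 0" by (intro add_pos_nonneg) auto
  have cn: "cnj a * exp (cnj L) = cnj (a * exp L)" "cnj b * exp (- cnj L) = cnj (b * exp (- L))"
    by (simp_all add: exp_cnj)
  have "2 * (x * y) \<le> x\<^sup>2 + y\<^sup>2" using sum_squares_bound[of x y] by simp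
  then show "cmod (soliton_u a b L) \<le> 1" "cmod (soliton_v a b L) \<le> 1"
    using w0 unfolding soliton_u_def soliton_v_def norm_divide w cn
    by (simp_all only: norm_mult complex_mod_cnj flip: x_def y_def) (simp_all add: norm_mult x_def y_def divide_simps algebra_simps)
  have "cmod (a * exp L * cnj (a * exp L) - b * exp (- L) * cnj (b * exp (- L))) \<le> x\<^sup>2 + y\<^sup>2"
    by (rule order.trans[OF norm_triangle_ineq4]) (simp only: norm_mult[of _ "cnj _"] complex_mod_cnj x_def y_def power2_eq_square order.refl)
  then show "cmod (soliton_T a b L) \<le> 1"
    using w0 unfolding soliton_T_def norm_divide w cn by simp
qed

text \<open>The bound does not depend on \<open>L\<close>. So the constant \<open>R\<close> of
  \<open>soliton_row_limit\<close> can be fixed although the coefficient k varies with the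
  point.\<close>

lemma one_soliton_component_bound:
  assumes "a \<noteq> 0"
  shows "cmod ((Psi a b L ** Lam l ** matrix_inv (Psi a b L)) $ i $ j) \<le> 2 * cmod l"
proof -
  have m: "cmod ((l - cnj l) / 2) \<le> cmod l" and h: "cmod ((l + cnj l) / 2) \<le> cmod l"
    using norm_triangle_ineq4[of l "cnj l"] norm_triangle_ineq[of l "cnj l"] by (simp_all add: norm_divide)
  have *: "cmod ((l - cnj l) / 2 * z) \<le> cmod l" if "cmod z \<le> 1" for z
    unfolding norm_mult using mult_mono[OF m that] by simp
  note b = soliton_functions_bounded[OF assms, of b L]
  have "cmod ((l + cnj l) / 2 + (l - cnj l) / 2 * soliton_T a b L) \<le> 2 * cmod l"
     "cmod ((l + cnj l) / 2 - (l - cnj l) / 2 * soliton_T a b L) \<le> 2 * cmod l"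
    using h *[OF b(1)] by (smt (verit) norm_triangle_ineq norm_triangle_ineq4)+
  moreover have "cmod (- ((l - cnj l) / 2 * soliton_u a b L)) \<le> 2 * cmod l"
     "cmod (- ((l - cnj l) / 2 * soliton_v a b L)) \<le> 2 * cmod l"
    using *[OF b(2)] *[OF b(3)] norm_ge_zero[of l] unfolding norm_minus_cancel by linarith+
  ultimately show ?thesis
    unfolding Psi_conj_Lam[OF assms] by (cases i rule: exhaust_2[THEN disjE]; cases j rule: exhaust_2[THEN disjE]; simp)
qed

lemma Psi_matrix_inv_left:
  assumes "a \<noteq> 0"
  shows "matrix_inv (Psi a b L) ** Psi a b L = mat 1"
proof -
  have "a * exp L * (cnj a * exp (cnj L)) - cnj b * exp (- cnj L) * (- b * exp (- L)) = soliton_norm a b L"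
    by (simp add: soliton_norm_def)
  then have d: "a * exp L * (cnj a * exp (cnj L)) - cnj b * exp (- cnj L) * (- b * exp (- L)) \<noteq> 0"
    using soliton_norm_nonzero[OF assms] by simp
  show ?thesis
    unfolding Psi_def matrix_inv_mat2[OF d] by (rule mat2_inverse(2)[OF d])
qed

text \<open>In |a'/b'| each i contributes the quotient of |\<lambda>_I - \<lambda>_i| and
  |\<lambda>_I - cnj \<lambda>_i| or its reciprocal, according to \<epsilon>_i; the logarithm turns
  this choice into the factor \<epsilon>_i. Nonresonance keeps numerators and denominators
  nonzero.\<close>

lemma Xfun_phase_shift:
  assumes I: "I \<in> {1..n}" and nr: "nonresonant n l" and ab: "a I \<noteq> 0" "b I \<noteq> 0"
    and \<epsilon>: "\<forall>i\<in>{1..n} - {I}. \<epsilon> i = 1 \<or> \<epsilon> i = -1"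
  shows "a_asym n a l \<epsilon> I \<noteq> 0" "b_asym n b l \<epsilon> I \<noteq> 0"
    and "Xfun (a_asym n a l \<epsilon> I) (b_asym n b l \<epsilon> I) L = Xfun (a I) (b I) L + phase_shift n l \<epsilon> I"
proof -
  let ?K = "{1..n} - {I}"
  have nz: "l I - lam_sgn (l i) e \<noteq> 0" if "i \<in> ?K" for i e
    using nonresonant_lam_sgn(2)[OF nr I, of i e] that by auto
  show a: "a_asym n a l \<epsilon> I \<noteq> 0" and b: "b_asym n b l \<epsilon> I \<noteq> 0"
    using nz ab by (auto simp: a_asym_def b_asym_def)
  have "cmod (a_asym n a l \<epsilon> I / b_asym n b l \<epsilon> I) =
     cmod (a I / b I) * (\<Prod>i\<in>?K. cmod ((l I - lam_sgn (l i) (\<epsilon> i)) / (l I - lam_sgn (l i) (- \<epsilon> i))))"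
    by (simp add: a_asym_def b_asym_def norm_mult norm_divide prod_norm[symmetric] prod_dividef)
  then have "ln (cmod (a_asym n a l \<epsilon> I / b_asym n b l \<epsilon> I)) = ln (cmod (a I / b I)) +
      (\<Sum>i\<in>?K. ln (cmod ((l I - lam_sgn (l i) (\<epsilon> i)) / (l I - lam_sgn (l i) (- \<epsilon> i)))))"
    using ab nz by (subst ln_prod[symmetric]) (auto simp: ln_mult prod_pos)
  also have "(\<Sum>i\<in>?K. ln (cmod ((l I - lam_sgn (l i) (\<epsilon> i)) / (l I - lam_sgn (l i) (- \<epsilon> i))))) = phase_shift n l \<epsilon> I"
    unfolding phase_shift_def
  proof (intro sum.cong refl)
    fix i assume i: "i \<in> ?K"
    \<comment> \<open>\<open>lam_sgn\<close> returns the conjugate for every sign other than 1, in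
      particular for 0.\<close>
    have "l I - l i \<noteq> 0" "l I - cnj (l i) \<noteq> 0"
      using nz[OF i, of 1] nz[OF i, of 0] by (simp_all add: lam_sgn_def)
    then show "ln (cmod ((l I - lam_sgn (l i) (\<epsilon> i)) / (l I - lam_sgn (l i) (- \<epsilon> i)))) =
       \<epsilon> i * ln (cmod ((l I - l i) / (l I - cnj (l i))))"
      using bspec[OF \<epsilon> i] by (auto simp: lam_sgn_def norm_divide ln_div)
  qed
  finally show "Xfun (a_asym n a l \<epsilon> I) (b_asym n b l \<epsilon> I) L = Xfun (a I) (b I) L + phase_shift n l \<epsilon> I"
    by (simp add: Xfun_def)
qed

text \<open>The asymptotic form still varies with L_I, so convergence is a statement on the
  difference. Each entry of the difference is at most a constant times \<open>\<tau>\<close>, the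
  sum of the small column ratios, as soon as \<open>\<tau>\<close> is small.\<close>

lemma quasi_wronskian_asymptotics:
  fixes n I :: nat and a b l :: "nat \<Rightarrow> complex" and \<epsilon> :: "nat \<Rightarrow> real"
    and L :: "nat \<Rightarrow> 'x \<Rightarrow> complex"
  assumes I: "I \<in> {1..n}" and ab: "\<And>i. i \<in> {1..n} \<Longrightarrow> a i \<noteq> 0 \<and> b i \<noteq> 0"
    and nr: "nonresonant n l"
    and inv: "\<And>x. block_invertible {1..n} {1..n}
                (wronski_block (\<lambda>i. Psi (a i) (b i) (L i x)) (\<lambda>i. Lam (l i)))"
    and lim: "\<And>i. i \<in> {1..n} - {I} \<Longrightarrow>
            \<epsilon> i = 1 \<and> filterlim (\<lambda>x. Re (L i x)) at_top F \<or>
            \<epsilon> i = -1 \<and> filterlim (\<lambda>x. Re (L i x)) at_bot F"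
  shows "((\<lambda>x. quasi_wronskian n (\<lambda>i. Psi (a i) (b i) (L i x)) (\<lambda>i. Lam (l i))
             - J_asym n a b l \<epsilon> I (L I x)) \<longlongrightarrow> 0) F"
proof -
  let ?K = "{1..n} - {I}"
  let ?mu = "\<lambda>i. lam_sgn (l i) (\<epsilon> i)" and ?nu = "\<lambda>i. lam_sgn (l i) (- \<epsilon> i)"
  let ?P = "\<Prod>i\<in>?K. l I - ?mu i" and ?Q = "\<Prod>i\<in>?K. l I - ?nu i"
  have \<epsilon>: "\<forall>i\<in>{1..n} - {I}. \<epsilon> i = 1 \<or> \<epsilon> i = -1" using lim by blast
  have n1: "n \<ge> 1" using I by auto
  define R where "R = 2 * cmod (l I)"
  have R: "R \<ge> 0" by (simp add: R_def)
  obtain c M where c: "c > 0" and est: "\<And>A B q1 q2 e1 e2 k1 k2 \<tau>.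
    (\<forall>s\<in>{1..n}. A s \<noteq> 0 \<and> B s \<noteq> 0) \<Longrightarrow>
    cmod e1 \<le> 1 \<Longrightarrow> cmod e2 \<le> 1 \<Longrightarrow> cmod k1 \<le> R \<Longrightarrow> cmod k2 \<le> R \<Longrightarrow>
    (\<forall>s\<in>{1..n}. e1 * A s * l s ^ n - e2 * B s * l s ^ n
        + (\<Sum>r\<in>{1..n}. (q1 r * A s - q2 r * B s) * l s ^ (r - 1)) = 0) \<Longrightarrow>
    (\<forall>s\<in>{1..n}. e1 * cnj (B s) * cnj (l s) ^ n + e2 * cnj (A s) * cnj (l s) ^ n
        + (\<Sum>r\<in>{1..n}. (q1 r * cnj (B s) + q2 r * cnj (A s)) * cnj (l s) ^ (r - 1)) = 0) \<Longrightarrow>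
    (e1 * l I + k1) * (?P * A I) = (e2 * l I + k2) * (?Q * B I) \<Longrightarrow>
    (e1 * cnj (l I) + k1) * cnj (?Q * B I) + (e2 * cnj (l I) + k2) * cnj (?P * A I) = 0 \<Longrightarrow>
    \<tau> = (\<Sum>i\<in>?K. if \<epsilon> i = 1 then cmod (B i / A i) else cmod (A i / B i)) \<Longrightarrow> \<tau> \<le> c \<Longrightarrow>
    cmod (q1 1 - k1 * (\<Prod>i\<in>?K. - ?mu i)) \<le> M * \<tau> \<and> cmod (q2 1 - k2 * (\<Prod>i\<in>?K. - ?nu i)) \<le> M * \<tau>"
    using that by (rule soliton_row_limit[OF I nr \<epsilon> R])
  define A where "A = (\<lambda>x i. a i * exp (L i x))"
  define B where "B = (\<lambda>x i. b i * exp (- L i x))"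
  define \<tau> where "\<tau> = (\<lambda>x. \<Sum>i\<in>?K. if \<epsilon> i = 1 then cmod (B x i / A x i) else cmod (A x i / B x i))"
  let ?J = "\<lambda>x. quasi_wronskian n (\<lambda>i. Psi (a i) (b i) (L i x)) (\<lambda>i. Lam (l i))"
  let ?Jt = "\<lambda>x. J_asym n a b l \<epsilon> I (L I x)"
  have \<tau>0: "(\<tau> \<longlongrightarrow> 0) F"
    unfolding \<tau>_def
  proof (rule tendsto_null_sum)
    fix i assume "i \<in> ?K"
    then have i: "i \<in> {1..n} - {I}" by (simp add:)
    have e: "cmod (exp (- z) / exp z) = exp (- (2 * Re z))" "cmod (exp z / exp (- z)) = exp (2 * Re z)" for z
      by (simp_all add: norm_divide flip: exp_diff)
    have BA: "cmod (B x i / A x i) = cmod (b i / a i) * exp (- (2 * Re (L i x)))"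
      "cmod (A x i / B x i) = cmod (a i / b i) * exp (2 * Re (L i x))" for x
      unfolding e[symmetric] A_def B_def norm_mult[symmetric] by simp_all
    from lim[OF i] show "((\<lambda>x. if \<epsilon> i = 1 then cmod (B x i / A x i) else cmod (A x i / B x i)) \<longlongrightarrow> 0) F"
    proof (elim disjE conjE)
      assume e: "\<epsilon> i = 1" and f: "filterlim (\<lambda>x. Re (L i x)) at_top F"
      have "filterlim (\<lambda>x. - (2 * Re (L i x))) at_bot F"
        unfolding filterlim_uminus_at_bot minus_minus
        by (rule filterlim_tendsto_pos_mult_at_top[OF tendsto_const _ f]) simp
      from filterlim_compose[OF exp_at_bot this] show ?thesis
        unfolding BA using e by (auto intro: tendsto_mult_right_zero)
    next
      assume e: "\<epsilon> i = -1" and f: "filterlim (\<lambda>x. Re (L i x)) at_bot F"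
      have "filterlim (\<lambda>x. 2 * Re (L i x)) at_bot F"
        by (rule filterlim_tendsto_pos_mult_at_bot[OF tendsto_const _ f]) simp
      from filterlim_compose[OF exp_at_bot this] show ?thesis
        unfolding BA using e by (auto intro: tendsto_mult_right_zero)
    qed
  qed
  have bound: "cmod ((?J x - ?Jt x) $ i $ j) \<le> M * \<tau> x" if \<tau>c: "\<tau> x \<le> c" for x i j
  proof -
    obtain Qc where J: "?J x = Qc 1" and Qc: "\<And>s. s \<in> {1..n} \<Longrightarrow>
      Psi (a s) (b s) (L s x) ** mat_pow (Lam (l s)) n
        + (\<Sum>r\<in>{1..n}. Qc r ** (Psi (a s) (b s) (L s x) ** mat_pow (Lam (l s)) (r - 1))) = 0"
      using that by (rule quasi_wronskian_coeffs[OF n1 inv[of x]])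
    have Psi: "Psi (a s) (b s) (L s x) = mat2 (A x s) (cnj (B x s)) (- B x s) (cnj (A x s))" for s
      unfolding Psi_eq A_def B_def ..
    have entry: "(Psi (a s) (b s) (L s x) ** mat_pow (Lam (l s)) n) $ i $ j
        + (\<Sum>r\<in>{1..n}. (Qc r ** (Psi (a s) (b s) (L s x) ** mat_pow (Lam (l s)) (r - 1))) $ i $ j) = 0"
      if "s \<in> {1..n}" for s i j
      using arg_cong[OF Qc[OF that], of "\<lambda>m. m $ i $ j"] by simp
    have AB: "\<forall>s\<in>{1..n}. A x s \<noteq> 0 \<and> B x s \<noteq> 0" using ab by (auto simp: A_def B_def)
    let ?Psi' = "Psi (a_asym n a l \<epsilon> I) (b_asym n b l \<epsilon> I) (L I x)"
    \<comment> \<open>The origin of a' and b': with p and q the products over the \<mu>_i and the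
      \<nu>_i, diag(p, q) at \<lambda>_I maps the first column of psi_I to that of
      \<open>?Psi'\<close>, and at cnj \<lambda>_I it maps the second column to the second.\<close>
    have a': "a_asym n a l \<epsilon> I * exp (L I x) = ?P * A x I" and b': "b_asym n b l \<epsilon> I * exp (- L I x) = ?Q * B x I"
      by (simp_all add: a_asym_def b_asym_def A_def B_def)
    have a0: "a_asym n a l \<epsilon> I \<noteq> 0"
      using Xfun_phase_shift(1)[where a = a and b = b, OF I nr _ _ \<epsilon>] ab[OF I] by blast
    \<comment> \<open>The matrix for which z + k annihilates the columns of \<open>?Psi'\<close> at
      \<lambda>_I and its conjugate.\<close>
    define k where "k = - (?Psi' ** Lam (l I) ** matrix_inv ?Psi')"
    have Jt: "?Jt x = k ** D_asym n l \<epsilon> I"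
      by (simp add: J_asym_def Let_def k_def uminus_matrix_mult)
    have cardK: "n - 1 = card ?K" using I by (simp add:)
    \<comment> \<open>The value of diag(p, q) at 0; the sign (-1)^(n-1) is distributed over the n -
      1 factors.\<close>
    have D: "D_asym n l \<epsilon> I = mat2 (\<Prod>i\<in>?K. - ?mu i) 0 0 (\<Prod>i\<in>?K. - ?nu i)"
      unfolding D_asym_def cardK by (simp add: prod_uminus mult.commute)
    have k: "k ** ?Psi' = - (?Psi' ** Lam (l I))"
      unfolding k_def uminus_matrix_mult
      by (simp add: matrix_mul_assoc[symmetric] Psi_matrix_inv_left[OF a0])
    have Psi': "?Psi' = mat2 (?P * A x I) (cnj (?Q * B x I)) (- (?Q * B x I)) (cnj (?P * A x I))"
      unfolding Psi_eq a' b' ..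
    have keq: "(k ** ?Psi') $ i $ j = (- (?Psi' ** Lam (l I))) $ i $ j" for i j using k by simp
    have kR: "cmod (k $ i $ j) \<le> R" for i j
      using one_soliton_component_bound[OF a0] by (simp add: k_def R_def)
    \<comment> \<open>The leading coefficients of row \<open>i\<close> are the i-th row of the
      identity matrix.\<close>
    have row: "cmod (Qc 1 $ i $ 1 - k $ i $ 1 * (\<Prod>i\<in>?K. - ?mu i)) \<le> M * \<tau> x \<and>
        cmod (Qc 1 $ i $ 2 - k $ i $ 2 * (\<Prod>i\<in>?K. - ?nu i)) \<le> M * \<tau> x" for i :: 2
    proof (rule est[of "A x" "B x" "if i = 1 then 1 else 0" "if i = 1 then 0 else 1" "k $ i $ 1" "k $ i $ 2"
          "\<lambda>r. Qc r $ i $ 1" "\<lambda>r. Qc r $ i $ 2", OF AB _ _ kR kR _ _ _ _ _ \<tau>c])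
      show "\<forall>s\<in>{1..n}. (if i = 1 then 1 else 0) * A x s * l s ^ n - (if i = 1 then 0 else 1) * B x s * l s ^ n
        + (\<Sum>r\<in>{1..n}. (Qc r $ i $ 1 * A x s - Qc r $ i $ 2 * B x s) * l s ^ (r - 1)) = 0"
      proof
        fix s assume s: "s \<in> {1..n}"
        show "(if i = 1 then 1 else 0) * A x s * l s ^ n - (if i = 1 then 0 else 1) * B x s * l s ^ n
        + (\<Sum>r\<in>{1..n}. (Qc r $ i $ 1 * A x s - Qc r $ i $ 2 * B x s) * l s ^ (r - 1)) = 0"
          using entry[OF s, of i 1] exhaust_2[of i]
          by (auto simp: Psi mat_pow_Lam matrix_mult_component_22 algebra_simps)
      qed
      show "\<forall>s\<in>{1..n}. (if i = 1 then 1 else 0) * cnj (B x s) * cnj (l s) ^ n + (if i = 1 then 0 else 1) * cnj (A x s) * cnj (l s) ^ n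
        + (\<Sum>r\<in>{1..n}. (Qc r $ i $ 1 * cnj (B x s) + Qc r $ i $ 2 * cnj (A x s)) * cnj (l s) ^ (r - 1)) = 0"
      proof
        fix s assume s: "s \<in> {1..n}"
        show "(if i = 1 then 1 else 0) * cnj (B x s) * cnj (l s) ^ n + (if i = 1 then 0 else 1) * cnj (A x s) * cnj (l s) ^ n
        + (\<Sum>r\<in>{1..n}. (Qc r $ i $ 1 * cnj (B x s) + Qc r $ i $ 2 * cnj (A x s)) * cnj (l s) ^ (r - 1)) = 0"
          using entry[OF s, of i 2] exhaust_2[of i]
          by (auto simp: Psi mat_pow_Lam matrix_mult_component_22 algebra_simps)
      qed
      show "((if i = 1 then 1 else 0) * l I + k $ i $ 1) * (?P * A x I) = ((if i = 1 then 0 else 1) * l I + k $ i $ 2) * (?Q * B x I)"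
        using keq[of i 1] exhaust_2[of i] unfolding Psi' Lam_def
        by (auto simp: matrix_mult_component_22 algebra_simps)
      show "((if i = 1 then 1 else 0) * cnj (l I) + k $ i $ 1) * cnj (?Q * B x I) + ((if i = 1 then 0 else 1) * cnj (l I) + k $ i $ 2) * cnj (?P * A x I) = 0"
        using keq[of i 2] exhaust_2[of i] unfolding Psi' Lam_def
        by (auto simp: matrix_mult_component_22 algebra_simps)
      show "\<tau> x = (\<Sum>i\<in>?K. if \<epsilon> i = 1 then cmod (B x i / A x i) else cmod (A x i / B x i))"
        unfolding \<tau>_def ..
    qed auto
    then show ?thesis
      unfolding J Jt D using exhaust_2[of j] by (auto simp: matrix_mult_component_22)
  qed
  have "((\<lambda>x. (?J x - ?Jt x) $ i $ j) \<longlongrightarrow> 0) F" for i j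
  proof (rule Lim_null_comparison)
    have "eventually (\<lambda>x. \<tau> x < c) F" using \<tau>0 c by (rule order_tendstoD)
    then show "eventually (\<lambda>x. norm ((?J x - ?Jt x) $ i $ j) \<le> M * \<tau> x) F"
      by eventually_elim (rule bound, simp)
    show "((\<lambda>x. M * \<tau> x) \<longlongrightarrow> 0) F" using \<tau>0 by (rule tendsto_mult_right_zero)
  qed
  then show ?thesis
    by (auto intro!: vec_tendstoI)
qed

text \<open>In the density part the \<lambda>_i are nonzero so that \<open>Lam (l I)\<close> and
  \<open>D_asym\<close> are invertible, since the gauge fields contain the inverse of
  \<open>Jt\<close>. The same formula for the I-th 1-soliton shows that the shift is the only
  change.\<close>

theorem mainTheorem5:
  fixes n I :: nat
    and a b \<alpha> \<beta> l :: "nat \<Rightarrow> complex"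
    and \<epsilon> :: "nat \<Rightarrow> real"
    and F :: "(real^4) filter"
    and L :: "nat \<Rightarrow> real^4 \<Rightarrow> complex"
    and J Jt :: "real^4 \<Rightarrow> mat22"
  defines "L \<equiv> \<lambda>i. Lfun (\<alpha> i) (\<beta> i) (l i)"
    and "J \<equiv> \<lambda>x. quasi_wronskian n (\<lambda>i. Psi (a i) (b i) (L i x)) (\<lambda>i. Lam (l i))"
    and "Jt \<equiv> \<lambda>x. J_asym n a b l \<epsilon> I (L I x)"
  assumes "n \<ge> 2" and "I \<in> {1..n}"
    and "\<And>i. i \<in> {1..n} \<Longrightarrow> a i \<noteq> 0 \<and> b i \<noteq> 0"
    and "mutually_independent n L"
    and "nonresonant n l"
    and "\<And>x. block_invertible {1..n} {1..n}
                (wronski_block (\<lambda>i. Psi (a i) (b i) (L i x)) (\<lambda>i. Lam (l i)))"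
    and "filterlim norm at_top F"
    and "Bfun (L I) F"
    and "\<And>i. i \<in> {1..n} - {I} \<Longrightarrow>
            \<epsilon> i = 1 \<and> filterlim (\<lambda>x. Re (L i x)) at_top F \<or>
            \<epsilon> i = -1 \<and> filterlim (\<lambda>x. Re (L i x)) at_bot F"
  shows "((\<lambda>x. J x - Jt x) \<longlongrightarrow> 0) F \<and>
    ((\<forall>i\<in>{1..n}. l i \<noteq> 0) \<longrightarrow>
      (\<forall>x. lagrangian_density Jt x =
             soliton_density (\<alpha> I) (\<beta> I) (l I) (Xfun (a I) (b I) (L I x) + phase_shift n l \<epsilon> I)) \<and>
      (\<forall>x. lagrangian_density (\<lambda>y. one_soliton (a I) (b I) (l I) (L I y)) x =
             soliton_density (\<alpha> I) (\<beta> I) (l I) (Xfun (a I) (b I) (L I x))))"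
proof (intro conjI impI allI)
  have \<epsilon>: "\<forall>i\<in>{1..n} - {I}. \<epsilon> i = 1 \<or> \<epsilon> i = -1" using assms(12) by blast
  have ab: "a I \<noteq> 0" "b I \<noteq> 0" using assms(5,6) by auto
  show "((\<lambda>x. J x - Jt x) \<longlongrightarrow> 0) F"
    unfolding J_def Jt_def by (rule quasi_wronskian_asymptotics[OF assms(5,6,8,9,12)])
  fix x
  assume l: "\<forall>i\<in>{1..n}. l i \<noteq> 0"
  then have lI: "l I \<noteq> 0" using assms(5) by auto
  note shift = Xfun_phase_shift[where a = a and b = b, OF assms(5,8) ab \<epsilon>]
  have lam0: "lam_sgn (l i) e \<noteq> 0" if "i \<in> {1..n} - {I}" for i e
    using l that by (auto simp: lam_sgn_def)
  have D: "(- 1) ^ (n - 1) * (\<Prod>i\<in>{1..n} - {I}. lam_sgn (l i) (\<epsilon> i)) \<noteq> 0"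
    "(- 1) ^ (n - 1) * (\<Prod>i\<in>{1..n} - {I}. lam_sgn (l i) (- \<epsilon> i)) \<noteq> 0"
    using lam0 by auto
  have "lagrangian_density Jt x =
    soliton_density (\<alpha> I) (\<beta> I) (l I) (Xfun (a_asym n a l \<epsilon> I) (b_asym n b l \<epsilon> I) (L I x))"
    unfolding Jt_def L_def J_asym_def Let_def D_asym_def
    by (rule lagrangian_density_soliton[OF shift(1,2) lI D])
  then show "lagrangian_density Jt x =
      soliton_density (\<alpha> I) (\<beta> I) (l I) (Xfun (a I) (b I) (L I x) + phase_shift n l \<epsilon> I)"
    by (simp only: shift(3))
  have one: "one_soliton a b l L = - (Psi a b L ** Lam l ** matrix_inv (Psi a b L) ** mat2 1 0 0 1)" for a b l L
    unfolding mat2_one[symmetric] by (simp add: one_soliton_def)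
  show "lagrangian_density (\<lambda>y. one_soliton (a I) (b I) (l I) (L I y)) x =
      soliton_density (\<alpha> I) (\<beta> I) (l I) (Xfun (a I) (b I) (L I x))"
    unfolding one L_def by (rule lagrangian_density_soliton[OF ab lI one_neq_zero one_neq_zero])
qed

end
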